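(* Let $(M,\circ,e)$ be an F-manifold with an Euler vector field $E$ and a torsionless connection $\nabla$ on $\mathcal{T}_M$ (not assumed to be flat) such that $\nabla e=0$ and such that the endomorphism $\nabla E:\mathcal{T}_M\to\mathcal{T}_M$, $X\mapsto\nabla_XE$, is non-degenerate. Assume $E\circ$ is invertible on an open dense subset $U$ of $M$. On $U$ define a new product $X*Y=(E\circ)^{-1}(X\circ Y)$ and a new connection $\nabla^*_XY=\nabla_XY-\nabla_{X*Y}E$, and let $L=E\circ$. Then $(d_\nabla,d_{L\nabla^*})$ give rise to a differential bicomplex on the graded sheaf $\mathcal{T}_M\otimes_{\mathcal{O}_M}\Omega_M^\bullet$ (on $U$), i.e. $$d_\nabla^2=0,\qquad d_{L\nabla^*}^2=0,\qquad d_\nabla d_{L\nabla^*}+d_{L\nabla^*}d_\nabla=0,$$ if and only if the data $(\nabla,\circ,e,\nabla^*,*,E)$ define a bi-flat F-structure.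
   Context: Conventions: $M$ is a smooth, real analytic or complex manifold, $\mathcal{T}_M$ its tangent sheaf, $\mathcal{O}_M$ its structure sheaf, $\Omega_M^k$ the sheaf of $k$-forms ($k\ge 0$, $\Omega^0_M=\mathcal{O}_M$); in the complex case everything is holomorphic. $X,Y,Z,W,X_i$ denote arbitrary local sections of $\mathcal{T}_M$. F-manifold $(M,\circ,e)$: $\circ$ is an $\mathcal{O}_M$-bilinear commutative associative product on $\mathcal{T}_M$ with unit a global vector field $e$ ($e\circ X=X$), satisfying $[X\circ Y,W\circ Z]-[X\circ Y,Z]\circ W-[X\circ Y,W]\circ Z-X\circ[Y,Z\circ W]+X\circ[Y,Z]\circ W+X\circ[Y,W]\circ Z-Y\circ[X,Z\circ W]+Y\circ[X,Z]\circ W+Y\circ[X,W]\circ Z=0$. Flat F-manifold $(M,\nabla,\circ,e)$: an F-manifold with a connection $\nabla$ on $\mathcal{T}_M$ such that for every constant $\lambda$ the connection $(X,Y)\mapsto \nabla_XY-\lambda X\circ Y$ is flat and torsionless, and $\nabla e=0$. Euler vector field of an F-manifold: a global vector field $E$ with $[e,E]=e$ and $\mathcal{L}_E\circ=\circ$, i.e. $[E,X\circ Y]-[E,X]\circ Y-X\circ[E,Y]=X\circ Y$. Bi-flat F-structure $(\nabla,\circ,e,\nabla^*,*,E)$ on $M$: (i) $(\nabla,\circ,e)$ is a flat F-structure on $M$; (ii) $E$ is an Euler vector field for $(M,\circ,e)$ and the operator $E\circ$ is invertible at generic points, i.e. on an open dense subset $U$; (iii) on $U$, $X*Y=(E\circ)^{-1}(X\circ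 Y)$; (iv) $(\nabla^*,*,E)$ is a flat F-structure on $U$ (with unit $E$, so $\nabla^*E=0$); (v) $(d_\nabla-d_{\nabla^*})(X\circ)=0$ for all local $X$, i.e. $\nabla_Y(X\circ Z)-\nabla_Z(X\circ Y)=\nabla^*_Y(X\circ Z)-\nabla^*_Z(X\circ Y)$. Differentials: for a connection $D$ on $\mathcal{T}_M$ and an endomorphism $L$ of $\mathcal{T}_M$, the morphism $d_{LD}:\mathcal{T}_M\otimes\Omega^k_M\to\mathcal{T}_M\otimes\Omega^{k+1}_M$ is $$(d_{LD}\omega)(X_0,\dots,X_k)=\sum_{i=0}^k(-1)^iD_{LX_i}(\omega(X_0,\dots,\hat X_i,\dots,X_k))+\sum_{0\le i<j\le k}(-1)^{i+j}\omega([X_i,X_j]_L,X_0,\dots,\hat X_i,\dots,\hat X_j,\dots,X_k),$$ where $[X,Y]_L=[LX,Y]+[X,LY]-L[X,Y]$; and $d_D$ is the usual exterior covariant derivative, i.e. the same formula with $L=I$ (so $[X,Y]_I=[X,Y]$). No bigrading is required in the term "differential bicomplex". *)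

theory Defs
  imports "HOL-Analysis.Analysis" "HOL-Library.Function_Algebras"
begin

text \<open>
  The ground field is a type \<open>'k\<close> of class \<open>real_normed_field\<close>; by the Gelfand--Mazur theorem
  this means \<open>real\<close> or \<open>complex\<close>. The manifold is a whole type \<open>'p\<close>, and all sheaves are given by
  their sections over open subsets. The vector space structure on functions (hence on vector fields
  and on forms, which are iterated function types) is the pointwise one of
  \<open>Function_Algebras\<close>.
\<close>

section \<open>Manifolds\<close>

text \<open>\<open>'k\<^sup>n\<close>, as a subspace of \<open>nat \<Rightarrow> 'k\<close> (with the product topology); \<open>n = 0\<close> is allowed.\<close>

definition coord_space :: "nat \<Rightarrow> (nat \<Rightarrow> 'k::zero) set" where
  "coord_space n = {x. \<forall>i\<ge>n. x i = 0}"

text \<open>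
  Functions of class \<open>C\<^sup>k\<close> on an open subset \<open>S\<close> of \<open>coord_space n\<close>, by iterated partial derivatives
  over \<open>'k\<close>. If \<open>'k\<close> is \<open>complex\<close>, then already \<open>C\<^sup>1\<close> means holomorphic.
\<close>

fun Ck_on :: "nat \<Rightarrow> nat \<Rightarrow> (nat \<Rightarrow> 'k) set \<Rightarrow> ((nat \<Rightarrow> 'k) \<Rightarrow> 'k::real_normed_field) \<Rightarrow> bool" where
  "Ck_on 0 n S f \<longleftrightarrow> continuous_on S f"
| "Ck_on (Suc k) n S f \<longleftrightarrow> continuous_on S f \<and>
     (\<forall>i<n. \<exists>g. Ck_on k n S g \<and>
        (\<forall>x\<in>S. ((\<lambda>t. f (x(i := t))) has_field_derivative g x) (at (x i))))"

definition smooth_fun_on :: "nat \<Rightarrow> (nat \<Rightarrow> 'k) set \<Rightarrow> ((nat \<Rightarrow> 'k) \<Rightarrow> 'k::real_normed_field) \<Rightarrow> bool" where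
  "smooth_fun_on n S f \<longleftrightarrow> (\<forall>k. Ck_on k n S f)"

text \<open>Local expansion into a convergent power series, summed over the multi-indices \<open>m\<close>.\<close>

definition analytic_fun_on :: "nat \<Rightarrow> (nat \<Rightarrow> 'k) set \<Rightarrow> ((nat \<Rightarrow> 'k) \<Rightarrow> 'k::real_normed_field) \<Rightarrow> bool" where
  "analytic_fun_on n S f \<longleftrightarrow>
     (\<forall>a\<in>S. \<exists>r>0. \<exists>c :: (nat \<Rightarrow> nat) \<Rightarrow> 'k.
        \<forall>x\<in>coord_space n. (\<forall>i<n. norm (x i - a i) < r) \<longrightarrow>
          x \<in> S \<and>
          ((\<lambda>m. c m * (\<Prod>i<n. (x i - a i) ^ m i)) has_sum f x) {m. \<forall>i\<ge>n. m i = 0})"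

datatype regularity = Smooth | Analytic

text \<open>
  \<open>Smooth\<close> over \<open>real\<close>, \<open>Analytic\<close> over \<open>real\<close>, and either of the two over \<open>complex\<close> are the smooth, the
  real analytic and the holomorphic functions.
\<close>

definition model_fun_on ::
    "regularity \<Rightarrow> nat \<Rightarrow> (nat \<Rightarrow> 'k) set \<Rightarrow> ((nat \<Rightarrow> 'k) \<Rightarrow> 'k::real_normed_field) \<Rightarrow> bool" where
  "model_fun_on r = (case r of Smooth \<Rightarrow> smooth_fun_on | Analytic \<Rightarrow> analytic_fun_on)"

text \<open>
  A function on an open set \<open>V\<close> is represented by its extension by zero to \<open>'p\<close>, so that equality of
  sections is equality.
\<close>

definition restrict_fun :: "'p set \<Rightarrow> ('p \<Rightarrow> 'k::zero) \<Rightarrow> 'p \<Rightarrow> 'k" where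
  "restrict_fun V f = (\<lambda>x. if x \<in> V then f x else 0)"

definition function_sheaf ::
    "('p::topological_space set \<Rightarrow> ('p \<Rightarrow> 'k::real_normed_field) set) \<Rightarrow> bool" where
  "function_sheaf \<O> \<longleftrightarrow>
     (\<forall>V. open V \<longrightarrow>
        (\<forall>f\<in>\<O> V. restrict_fun V f = f \<and> continuous_on V f) \<and>
        (\<forall>c. restrict_fun V (\<lambda>_. c) \<in> \<O> V) \<and>
        (\<forall>f\<in>\<O> V. \<forall>g\<in>\<O> V. f + g \<in> \<O> V \<and> f * g \<in> \<O> V) \<and>
        (\<forall>f\<in>\<O> V. \<forall>W. open W \<and> W \<subseteq> V \<longrightarrow> restrict_fun W f \<in> \<O> W) \<and>
        (\<forall>f. restrict_fun V f = f \<and>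
             (\<forall>x\<in>V. \<exists>W. open W \<and> x \<in> W \<and> W \<subseteq> V \<and> restrict_fun W f \<in> \<O> W) \<longrightarrow> f \<in> \<O> V))"

text \<open>
  \<open>\<O>\<close> is the structure sheaf of an \<open>n\<close>-dimensional manifold of the given regularity: a sheaf of
  algebras of continuous functions which in suitable charts \<open>\<phi>\<close> (with inverse \<open>\<psi>\<close>) around any
  point is the sheaf of model functions on an open subset of \<open>'k\<^sup>n\<close>.
\<close>

definition manifold_sheaf ::
    "regularity \<Rightarrow> nat \<Rightarrow> ('p::{t2_space,second_countable_topology} set \<Rightarrow>
       ('p \<Rightarrow> 'k::real_normed_field) set) \<Rightarrow> bool" where
  "manifold_sheaf r n \<O> \<longleftrightarrow>
     function_sheaf \<O> \<and>
     (\<forall>p. \<exists>V S \<phi> \<psi>. open V \<and> p \<in> V \<and> openin (top_of_set (coord_space n)) S \<and>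
        homeomorphism V S \<phi> \<psi> \<and>
        (\<forall>W f. open W \<and> W \<subseteq> V \<and> restrict_fun W f = f \<longrightarrow>
           (f \<in> \<O> W \<longleftrightarrow> model_fun_on r n (\<phi> ` W) (\<lambda>y. f (\<psi> y)))))"

section \<open>The tangent sheaf\<close>

text \<open>
  The tangent sheaf is the sheaf of derivations of \<open>\<O>\<close>: a section over \<open>V\<close> is a family of derivations
  \<open>X W : \<O> W \<rightarrow> \<O> W\<close>, for \<open>W \<subseteq> V\<close> open, compatible with restriction. Outside this domain the family is
  required to be zero, so that again equality of sections is equality.
\<close>

type_synonym ('p, 'k) vfield = "'p set \<Rightarrow> ('p \<Rightarrow> 'k) \<Rightarrow> 'p \<Rightarrow> 'k"

definition vector_fields ::
    "('p::topological_space set \<Rightarrow> ('p \<Rightarrow> 'k::real_normed_field) set) \<Rightarrow> 'p set \<Rightarrow> ('p, 'k) vfield set" where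
  "vector_fields \<O> V = {X.
     (\<forall>W f. \<not> (open W \<and> W \<subseteq> V \<and> f \<in> \<O> W) \<longrightarrow> X W f = 0) \<and>
     (\<forall>W. open W \<and> W \<subseteq> V \<longrightarrow>
        (\<forall>f\<in>\<O> W. X W f \<in> \<O> W \<and>
           (\<forall>c. X W (\<lambda>x. c * f x) = (\<lambda>x. c * X W f x)) \<and>
           (\<forall>g\<in>\<O> W. X W (f + g) = X W f + X W g \<and> X W (f * g) = f * X W g + g * X W f) \<and>
           (\<forall>W'. open W' \<and> W' \<subseteq> W \<longrightarrow> X W' (restrict_fun W' f) = restrict_fun W' (X W f))))}"

definition restrict_vf :: "'p set \<Rightarrow> ('p, 'k::zero) vfield \<Rightarrow> ('p, 'k) vfield" where
  "restrict_vf V X = (\<lambda>W f x. if W \<subseteq> V then X W f x else 0)"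

definition scale_vf :: "('p \<Rightarrow> 'k::times) \<Rightarrow> ('p, 'k) vfield \<Rightarrow> ('p, 'k) vfield" where
  "scale_vf f X = (\<lambda>W g x. f x * X W g x)"

definition const_scale_vf :: "'k::times \<Rightarrow> ('p, 'k) vfield \<Rightarrow> ('p, 'k) vfield" where
  "const_scale_vf c = scale_vf (\<lambda>_. c)"

definition lie_bracket :: "('p, 'k::minus) vfield \<Rightarrow> ('p, 'k) vfield \<Rightarrow> ('p, 'k) vfield" where
  "lie_bracket X Y = (\<lambda>W f. X W (Y W f) - Y W (X W f))"

section \<open>Products and connections\<close>

text \<open>
  Endomorphisms of the tangent sheaf and binary operations on it are families of maps indexed by the
  open set over which their arguments are sections. All structures below are considered over an
  open subset \<open>A\<close> of the manifold.
\<close>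

type_synonym ('p, 'k) op1 = "'p set \<Rightarrow> ('p, 'k) vfield \<Rightarrow> ('p, 'k) vfield"
type_synonym ('p, 'k) op2 = "'p set \<Rightarrow> ('p, 'k) vfield \<Rightarrow> ('p, 'k) vfield \<Rightarrow> ('p, 'k) vfield"

definition sheaf_op2 ::
    "('p::topological_space set \<Rightarrow> ('p \<Rightarrow> 'k::real_normed_field) set) \<Rightarrow> 'p set \<Rightarrow> ('p, 'k) op2 \<Rightarrow> bool" where
  "sheaf_op2 \<O> A m \<longleftrightarrow>
     (\<forall>V. open V \<and> V \<subseteq> A \<longrightarrow>
        (\<forall>X\<in>vector_fields \<O> V. \<forall>Y\<in>vector_fields \<O> V.
           m V X Y \<in> vector_fields \<O> V \<and>
           (\<forall>W. open W \<and> W \<subseteq> V \<longrightarrow>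
              m W (restrict_vf W X) (restrict_vf W Y) = restrict_vf W (m V X Y))))"

definition F_manifold ::
    "('p::topological_space set \<Rightarrow> ('p \<Rightarrow> 'k::real_normed_field) set) \<Rightarrow> 'p set \<Rightarrow>
     ('p, 'k) op2 \<Rightarrow> ('p, 'k) vfield \<Rightarrow> bool" where
  "F_manifold \<O> A m e \<longleftrightarrow>
     sheaf_op2 \<O> A m \<and> e \<in> vector_fields \<O> A \<and>
     (\<forall>V. open V \<and> V \<subseteq> A \<longrightarrow>
        (\<forall>X\<in>vector_fields \<O> V. \<forall>Y\<in>vector_fields \<O> V. \<forall>Z\<in>vector_fields \<O> V.
           m V (X + Y) Z = m V X Z + m V Y Z \<and>
           m V Z (X + Y) = m V Z X + m V Z Y \<and>
           (\<forall>f\<in>\<O> V. m V (scale_vf f X) Y = scale_vf f (m V X Y) \<and>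
                     m V X (scale_vf f Y) = scale_vf f (m V X Y)) \<and>
           m V X Y = m V Y X \<and>
           m V (m V X Y) Z = m V X (m V Y Z) \<and>
           m V (restrict_vf V e) X = X \<and>
           (\<forall>W\<in>vector_fields \<O> V.
              lie_bracket (m V X Y) (m V W Z)
              - m V (lie_bracket (m V X Y) Z) W - m V (lie_bracket (m V X Y) W) Z
              - m V X (lie_bracket Y (m V Z W))
              + m V X (m V (lie_bracket Y Z) W) + m V X (m V (lie_bracket Y W) Z)
              - m V Y (lie_bracket X (m V Z W))
              + m V Y (m V (lie_bracket X Z) W) + m V Y (m V (lie_bracket X W) Z) = 0)))"

definition connection ::
    "('p::topological_space set \<Rightarrow> ('p \<Rightarrow> 'k::real_normed_field) set) \<Rightarrow> 'p set \<Rightarrow> ('p, 'k) op2 \<Rightarrow> bool" where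
  "connection \<O> A D \<longleftrightarrow>
     sheaf_op2 \<O> A D \<and>
     (\<forall>V. open V \<and> V \<subseteq> A \<longrightarrow>
        (\<forall>X\<in>vector_fields \<O> V. \<forall>Y\<in>vector_fields \<O> V.
           (\<forall>Z\<in>vector_fields \<O> V.
              D V (X + Y) Z = D V X Z + D V Y Z \<and> D V Z (X + Y) = D V Z X + D V Z Y) \<and>
           (\<forall>f\<in>\<O> V. D V (scale_vf f X) Y = scale_vf f (D V X Y) \<and>
                     D V X (scale_vf f Y) = scale_vf (X V f) Y + scale_vf f (D V X Y))))"

definition torsionless ::
    "('p::topological_space set \<Rightarrow> ('p \<Rightarrow> 'k::real_normed_field) set) \<Rightarrow> 'p set \<Rightarrow> ('p, 'k) op2 \<Rightarrow> bool" where
  "torsionless \<O> A D \<longleftrightarrow>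
     (\<forall>V. open V \<and> V \<subseteq> A \<longrightarrow>
        (\<forall>X\<in>vector_fields \<O> V. \<forall>Y\<in>vector_fields \<O> V. D V X Y - D V Y X = lie_bracket X Y))"

definition flat ::
    "('p::topological_space set \<Rightarrow> ('p \<Rightarrow> 'k::real_normed_field) set) \<Rightarrow> 'p set \<Rightarrow> ('p, 'k) op2 \<Rightarrow> bool" where
  "flat \<O> A D \<longleftrightarrow>
     (\<forall>V. open V \<and> V \<subseteq> A \<longrightarrow>
        (\<forall>X\<in>vector_fields \<O> V. \<forall>Y\<in>vector_fields \<O> V. \<forall>Z\<in>vector_fields \<O> V.
           D V X (D V Y Z) - D V Y (D V X Z) - D V (lie_bracket X Y) Z = 0))"

definition parallel ::
    "('p::topological_space set \<Rightarrow> ('p \<Rightarrow> 'k::real_normed_field) set) \<Rightarrow> 'p set \<Rightarrow>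
     ('p, 'k) op2 \<Rightarrow> ('p, 'k) vfield \<Rightarrow> bool" where
  "parallel \<O> A D e \<longleftrightarrow>
     (\<forall>V. open V \<and> V \<subseteq> A \<longrightarrow> (\<forall>X\<in>vector_fields \<O> V. D V X (restrict_vf V e) = 0))"

definition flat_F_structure ::
    "('p::topological_space set \<Rightarrow> ('p \<Rightarrow> 'k::real_normed_field) set) \<Rightarrow> 'p set \<Rightarrow>
     ('p, 'k) op2 \<Rightarrow> ('p, 'k) op2 \<Rightarrow> ('p, 'k) vfield \<Rightarrow> bool" where
  "flat_F_structure \<O> A D m e \<longleftrightarrow>
     F_manifold \<O> A m e \<and> connection \<O> A D \<and>
     (\<forall>c. flat \<O> A (\<lambda>V X Y. D V X Y - const_scale_vf c (m V X Y)) \<and>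
          torsionless \<O> A (\<lambda>V X Y. D V X Y - const_scale_vf c (m V X Y))) \<and>
     parallel \<O> A D e"

definition euler_field ::
    "('p::topological_space set \<Rightarrow> ('p \<Rightarrow> 'k::real_normed_field) set) \<Rightarrow> 'p set \<Rightarrow>
     ('p, 'k) op2 \<Rightarrow> ('p, 'k) vfield \<Rightarrow> ('p, 'k) vfield \<Rightarrow> bool" where
  "euler_field \<O> A m e E \<longleftrightarrow>
     E \<in> vector_fields \<O> A \<and> lie_bracket e E = e \<and>
     (\<forall>V. open V \<and> V \<subseteq> A \<longrightarrow>
        (\<forall>X\<in>vector_fields \<O> V. \<forall>Y\<in>vector_fields \<O> V.
           lie_bracket (restrict_vf V E) (m V X Y)
           - m V (lie_bracket (restrict_vf V E) X) Y
           - m V X (lie_bracket (restrict_vf V E) Y) = m V X Y))"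

text \<open>
  For an \<open>\<O>\<close>-linear endomorphism, bijectivity on all section spaces is invertibility as a sheaf
  morphism, which on the (locally free) tangent sheaf is the same as fibrewise invertibility.
\<close>

definition invertible_op1 ::
    "('p::topological_space set \<Rightarrow> ('p \<Rightarrow> 'k::real_normed_field) set) \<Rightarrow> 'p set \<Rightarrow> ('p, 'k) op1 \<Rightarrow> bool" where
  "invertible_op1 \<O> A L \<longleftrightarrow>
     (\<forall>V. open V \<and> V \<subseteq> A \<longrightarrow> bij_betw (L V) (vector_fields \<O> V) (vector_fields \<O> V))"

definition mult_op :: "('p, 'k::zero) op2 \<Rightarrow> ('p, 'k) vfield \<Rightarrow> ('p, 'k) op1" where
  "mult_op m E = (\<lambda>V X. m V (restrict_vf V E) X)"

definition nabla_op :: "('p, 'k::zero) op2 \<Rightarrow> ('p, 'k) vfield \<Rightarrow> ('p, 'k) op1" where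
  "nabla_op D E = (\<lambda>V X. D V X (restrict_vf V E))"

definition dual_product ::
    "('p::topological_space set \<Rightarrow> ('p \<Rightarrow> 'k::real_normed_field) set) \<Rightarrow>
     ('p, 'k) op2 \<Rightarrow> ('p, 'k) vfield \<Rightarrow> ('p, 'k) op2" where
  "dual_product \<O> m E = (\<lambda>V X Y. the_inv_into (vector_fields \<O> V) (mult_op m E V) (m V X Y))"

definition dual_connection ::
    "('p::topological_space set \<Rightarrow> ('p \<Rightarrow> 'k::real_normed_field) set) \<Rightarrow>
     ('p, 'k) op2 \<Rightarrow> ('p, 'k) op2 \<Rightarrow> ('p, 'k) vfield \<Rightarrow> ('p, 'k) op2" where
  "dual_connection \<O> D m E = (\<lambda>V X Y. D V X Y - nabla_op D E V (dual_product \<O> m E V X Y))"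

text \<open>
  The structure \<open>(D, m, e)\<close> lives on the whole manifold, the dual structure \<open>(D', m', E)\<close> on the
  open dense subset \<open>U\<close> on which multiplication by \<open>E\<close> is invertible.
\<close>

definition biflat_F_structure ::
    "('p::topological_space set \<Rightarrow> ('p \<Rightarrow> 'k::real_normed_field) set) \<Rightarrow> 'p set \<Rightarrow>
     ('p, 'k) op2 \<Rightarrow> ('p, 'k) op2 \<Rightarrow> ('p, 'k) vfield \<Rightarrow>
     ('p, 'k) op2 \<Rightarrow> ('p, 'k) op2 \<Rightarrow> ('p, 'k) vfield \<Rightarrow> bool" where
  "biflat_F_structure \<O> U D m e D' m' E \<longleftrightarrow>
     flat_F_structure \<O> UNIV D m e \<and>
     euler_field \<O> UNIV m e E \<and>
     open U \<and> closure U = UNIV \<and> invertible_op1 \<O> U (mult_op m E) \<and>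
     (\<forall>V. open V \<and> V \<subseteq> U \<longrightarrow>
        (\<forall>X\<in>vector_fields \<O> V. \<forall>Y\<in>vector_fields \<O> V. m' V X Y = dual_product \<O> m E V X Y)) \<and>
     flat_F_structure \<O> U D' m' (restrict_vf U E) \<and>
     (\<forall>V. open V \<and> V \<subseteq> U \<longrightarrow>
        (\<forall>X\<in>vector_fields \<O> V. \<forall>Y\<in>vector_fields \<O> V. \<forall>Z\<in>vector_fields \<O> V.
           D V Y (m V X Z) - D V Z (m V X Y) = D' V Y (m V X Z) - D' V Z (m V X Y)))"

section \<open>Vector-valued forms and their differentials\<close>

text \<open>
  As the tangent sheaf is locally free of finite rank, sections over \<open>V\<close> of its tensor product with
  the sheaf of \<open>k\<close>-forms are the alternating \<open>\<O>\<close>-multilinear sheaf morphisms over \<open>V\<close> taking \<open>k\<close>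
  vector fields to a vector field. The \<open>k\<close> arguments are passed as a list; only the values on lists
  of \<open>k\<close> vector fields over open subsets of \<open>V\<close> are relevant.
\<close>

type_synonym ('p, 'k) tform = "'p set \<Rightarrow> ('p, 'k) vfield list \<Rightarrow> ('p, 'k) vfield"

definition tforms ::
    "('p::topological_space set \<Rightarrow> ('p \<Rightarrow> 'k::real_normed_field) set) \<Rightarrow> 'p set \<Rightarrow> nat \<Rightarrow> ('p, 'k) tform set" where
  "tforms \<O> V k = {\<omega>. \<forall>W. open W \<and> W \<subseteq> V \<longrightarrow>
     (\<forall>xs. set xs \<subseteq> vector_fields \<O> W \<and> length xs = k \<longrightarrow>
        \<omega> W xs \<in> vector_fields \<O> W \<and>
        (\<forall>W'. open W' \<and> W' \<subseteq> W \<longrightarrow>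
           \<omega> W' (map (restrict_vf W') xs) = restrict_vf W' (\<omega> W xs)) \<and>
        (\<forall>i<k. \<forall>Y\<in>vector_fields \<O> W. \<forall>Z\<in>vector_fields \<O> W.
           \<omega> W (xs[i := Y + Z]) = \<omega> W (xs[i := Y]) + \<omega> W (xs[i := Z]) \<and>
           (\<forall>f\<in>\<O> W. \<omega> W (xs[i := scale_vf f Y]) = scale_vf f (\<omega> W (xs[i := Y])))) \<and>
        (\<forall>i j. i < j \<and> j < k \<and> xs ! i = xs ! j \<longrightarrow> \<omega> W xs = 0))}"

definition remove_nth :: "nat \<Rightarrow> 'a list \<Rightarrow> 'a list" where
  "remove_nth i xs = take i xs @ drop (Suc i) xs"

definition twisted_bracket :: "('p, 'k::real_normed_field) op1 \<Rightarrow> ('p, 'k) op2" where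
  "twisted_bracket L V X Y =
     lie_bracket (L V X) Y + lie_bracket X (L V Y) - L V (lie_bracket X Y)"

text \<open>
  \<open>d_op L D\<close> is the differential built from the connection \<open>D\<close> and the endomorphism \<open>L\<close>. The degree
  of the form is one less than the number of arguments. In the second sum \<open>j\<close> is removed before
  \<open>i < j\<close>, so that the position of \<open>i\<close> does not shift.
\<close>

definition d_op :: "('p, 'k::real_normed_field) op1 \<Rightarrow> ('p, 'k) op2 \<Rightarrow> ('p, 'k) tform \<Rightarrow> ('p, 'k) tform" where
  "d_op L D \<omega> = (\<lambda>V xs.
     (\<Sum>i<length xs. const_scale_vf ((-1) ^ i) (D V (L V (xs ! i)) (\<omega> V (remove_nth i xs)))) +
     (\<Sum>j<length xs. \<Sum>i<j. const_scale_vf ((-1) ^ (i + j))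
        (\<omega> V (twisted_bracket L V (xs ! i) (xs ! j) # remove_nth i (remove_nth j xs)))))"

definition id_op :: "('p, 'k) op1" where
  "id_op = (\<lambda>V X. X)"

text \<open>Vanishing of a \<open>k\<close>-form over \<open>V\<close>.\<close>

definition zero_form ::
    "('p::topological_space set \<Rightarrow> ('p \<Rightarrow> 'k::real_normed_field) set) \<Rightarrow> 'p set \<Rightarrow> nat \<Rightarrow> ('p, 'k) tform \<Rightarrow> bool" where
  "zero_form \<O> V k \<eta> \<longleftrightarrow>
     (\<forall>W. open W \<and> W \<subseteq> V \<longrightarrow>
        (\<forall>xs. set xs \<subseteq> vector_fields \<O> W \<and> length xs = k \<longrightarrow> \<eta> W xs = 0))"

definition differential_bicomplex ::
    "('p::topological_space set \<Rightarrow> ('p \<Rightarrow> 'k::real_normed_field) set) \<Rightarrow> 'p set \<Rightarrow>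
     (('p, 'k) tform \<Rightarrow> ('p, 'k) tform) \<Rightarrow> (('p, 'k) tform \<Rightarrow> ('p, 'k) tform) \<Rightarrow> bool" where
  "differential_bicomplex \<O> U d d' \<longleftrightarrow>
     (\<forall>V k. open V \<and> V \<subseteq> U \<longrightarrow>
        (\<forall>\<omega>\<in>tforms \<O> V k.
           zero_form \<O> V (k + 2) (d (d \<omega>)) \<and>
           zero_form \<O> V (k + 2) (d' (d' \<omega>)) \<and>
           zero_form \<O> V (k + 2) (d (d' \<omega>) + d' (d \<omega>))))"

end

theory Submission
  imports Defs
begin

text \<open>
  Write \<open>R\<close> for the curvature of the torsionless connection \<open>D\<close>, \<open>P\<close> for the endomorphism \<open>X \<mapsto> D\<^sub>X E\<close> and
  \<open>L = E\<circ>\<close>, so that \<open>D\<^sup>*\<^sub>X Y = D\<^sub>X Y - P (X * Y)\<close>. Further let \<open>H(X, Y) = D\<^sub>X (P Y) - P (D\<^sub>X Y)\<close> be the second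
  covariant derivative of \<open>E\<close>, and let \<open>T(X, Y, Z) = (D\<^sub>X \<circ>)(Y, Z) - (D\<^sub>Y \<circ>)(X, Z)\<close> be the obstruction to the
  total symmetry of the derivative of the product. The pair \<open>(D, \<circ>)\<close> is a flat F-structure exactly when
  \<open>R = 0\<close> and \<open>T = 0\<close>: the curvature of \<open>D - \<lambda>\<circ>\<close> is \<open>R - \<lambda>T\<close>, and \<open>T = 0\<close> implies the Hertling--Manin identity.

  Each of the two differentials is the Chevalley--Eilenberg differential of a Lie bracket on vector
  fields acting on vector fields. For \<open>d = d\<^sub>D\<close> this is the usual bracket acting through \<open>D\<close>. For the other
  one, \<open>d'\<close>, it is \<open>[X, Y]\<^sub>L\<close>, where \<open>X\<close> acts as \<open>D\<^sup>*\<close> in the direction \<open>L X\<close>; as \<open>E\<close> is an Euler field, the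
  Nijenhuis torsion of \<open>L\<close> vanishes, that is \<open>L [X, Y]\<^sub>L = [L X, L Y]\<close>. Evaluated on forms of degree zero, that
  is on vector fields, the three equations of a bicomplex say that \<open>R = 0\<close>, that the curvature \<open>R\<^sup>*\<close> of \<open>D\<^sup>*\<close>
  vanishes and that the mixed curvature

    \<open>S(X, Y, Z) = R(L X, Y) Z + R(X, L Y) Z - H(X, Y \<circ> Z) + H(Y, X \<circ> Z) - P T(X, Y, Z)\<close>

  vanishes. Conversely these three conditions suffice in every degree. The bracket and the action of
  \<open>d + d'\<close> are the sums of those of \<open>d\<close> and \<open>d'\<close>. The sum of the brackets is the one deformed by \<open>I + L\<close>, whose
  Nijenhuis torsion vanishes as well, and \<open>S = 0\<close> is what makes the sum of the actions an action. So \<open>d\<close>, \<open>d'\<close>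
  and \<open>d + d'\<close> all square to zero, and expanding the square of the sum shows that \<open>d\<close> and \<open>d'\<close> anticommute.

  From a bicomplex to a bi-flat structure: as \<open>D\<^sub>e\<close> is a derivation of the product, \<open>T(e, Y, Z) = 0\<close>, so
  \<open>S(e, Y, Z) = 0\<close> with \<open>R = 0\<close> gives \<open>H(Y, Z) = H(e, Y \<circ> Z)\<close>. Hence the two terms with \<open>H\<close> in \<open>S\<close> cancel,
  \<open>P T = 0\<close>, and \<open>T = 0\<close> because \<open>P\<close> is non-degenerate (lemma \<open>codazzi_if_mixed\<close>). Next, \<open>T = 0\<close> and the
  Euler property give

    \<open>D\<^sup>*\<^sub>X (E \<circ> W) = E \<circ> D\<^sub>X W + X \<circ> (W - P W)\<close>,

  from which \<open>T\<^sup>* = 0\<close> for the dual structure (lemma \<open>dual_codazzi\<close>), so that \<open>(D\<^sup>*, *)\<close> is a flat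
  F-structure. All this holds on \<open>U\<close>; as functions are continuous, \<open>R = 0\<close> and \<open>T = 0\<close> extend from the dense
  set \<open>U\<close> to the manifold.

  From a bi-flat structure to a bicomplex: the same formula for \<open>D\<^sup>*\<^sub>X (E \<circ> W)\<close> gives
  \<open>R\<^sup>*(X, Y)(E \<circ> Z) = S(X, Y, Z)\<close> whenever \<open>R = 0\<close> and \<open>T = 0\<close> (lemma \<open>dual_curvature_eq_mixed\<close>), so \<open>S\<close>
  vanishes together with \<open>R\<^sup>*\<close>. The last condition of a bi-flat structure, on the difference of \<open>D\<close> and
  \<open>D\<^sup>*\<close>, holds because \<open>Y * (X \<circ> Z)\<close> is symmetric in \<open>Y\<close> and \<open>Z\<close>.
\<close>

section \<open>The complex of a Lie algebra action\<close>

text \<open>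
  The sections of the tangent sheaf over an open set form a subgroup of a function type, and the
  operations on them behave well on this subgroup only. So all algebra is done relative to a carrier.
\<close>
locale additive_subgroup =
  fixes G :: "'a::ab_group_add set"
  assumes zero_closed [simp]: "0 \<in> G"
    and add_closed [simp]: "x \<in> G \<Longrightarrow> y \<in> G \<Longrightarrow> x + y \<in> G"
    and minus_closed [simp]: "x \<in> G \<Longrightarrow> - x \<in> G"
begin

lemma diff_closed [simp]: "x \<in> G \<Longrightarrow> y \<in> G \<Longrightarrow> x - y \<in> G"
  using add_closed[of x "- y"] by simp

end

text \<open>
  The common denominator of products, brackets and connections: a connection is not bilinear over
  functions, but it is biadditive.
\<close>
definition biadditive_on :: "'a::ab_group_add set \<Rightarrow> ('a \<Rightarrow> 'a \<Rightarrow> 'a) \<Rightarrow> bool" where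
  "biadditive_on G b \<longleftrightarrow> (\<forall>x\<in>G. \<forall>y\<in>G. b x y \<in> G \<and>
     (\<forall>z\<in>G. b (x + y) z = b x z + b y z \<and> b z (x + y) = b z x + b z y))"

context additive_subgroup
begin

lemma biadditive_onD:
  assumes "biadditive_on G b"
  shows "x \<in> G \<Longrightarrow> y \<in> G \<Longrightarrow> b x y \<in> G"
    and "x \<in> G \<Longrightarrow> y \<in> G \<Longrightarrow> z \<in> G \<Longrightarrow> b (x + y) z = b x z + b y z"
    and "x \<in> G \<Longrightarrow> y \<in> G \<Longrightarrow> z \<in> G \<Longrightarrow> b z (x + y) = b z x + b z y"
    and "y \<in> G \<Longrightarrow> b 0 y = 0" and "x \<in> G \<Longrightarrow> b x 0 = 0"
    and "x \<in> G \<Longrightarrow> y \<in> G \<Longrightarrow> b (- x) y = - b x y"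
    and "x \<in> G \<Longrightarrow> y \<in> G \<Longrightarrow> b x (- y) = - b x y"
    and "x \<in> G \<Longrightarrow> y \<in> G \<Longrightarrow> z \<in> G \<Longrightarrow> b (x - y) z = b x z - b y z"
    and "x \<in> G \<Longrightarrow> y \<in> G \<Longrightarrow> z \<in> G \<Longrightarrow> b z (x - y) = b z x - b z y"
proof -
  have add1: "b (u + v) w = b u w + b v w" and add2: "b w (u + v) = b w u + b w v"
    if "u \<in> G" "v \<in> G" "w \<in> G" for u v w
    using assms that by (auto simp: biadditive_on_def)
  have z1: "b 0 w = 0" and z2: "b w 0 = 0" if "w \<in> G" for w
    using add1[of 0 0 w] add2[of 0 0 w] that by auto
  have m1: "b (- u) w = - b u w" and m2: "b w (- u) = - b w u" if "u \<in> G" "w \<in> G" for u w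
    using add1[of u "- u" w] add2[of u "- u" w] that z1[of w] z2[of w]
    by (simp_all add: eq_neg_iff_add_eq_0 add.commute)
  have "b (u - v) w = b u w - b v w" "b w (u - v) = b w u - b w v"
    if "u \<in> G" "v \<in> G" "w \<in> G" for u v w
    using add1[of u "- v" w] add2[of u "- v" w] m1 m2 that by auto
  then show "x \<in> G \<Longrightarrow> y \<in> G \<Longrightarrow> b x y \<in> G"
    and "x \<in> G \<Longrightarrow> y \<in> G \<Longrightarrow> z \<in> G \<Longrightarrow> b (x + y) z = b x z + b y z"
    and "x \<in> G \<Longrightarrow> y \<in> G \<Longrightarrow> z \<in> G \<Longrightarrow> b z (x + y) = b z x + b z y"
    and "y \<in> G \<Longrightarrow> b 0 y = 0" and "x \<in> G \<Longrightarrow> b x 0 = 0"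
    and "x \<in> G \<Longrightarrow> y \<in> G \<Longrightarrow> b (- x) y = - b x y"
    and "x \<in> G \<Longrightarrow> y \<in> G \<Longrightarrow> b x (- y) = - b x y"
    and "x \<in> G \<Longrightarrow> y \<in> G \<Longrightarrow> z \<in> G \<Longrightarrow> b (x - y) z = b x z - b y z"
    and "x \<in> G \<Longrightarrow> y \<in> G \<Longrightarrow> z \<in> G \<Longrightarrow> b z (x - y) = b z x - b z y"
    using assms add1 add2 z1 z2 m1 m2 by (simp_all add: biadditive_on_def)
qed

end

text \<open>
  A form is a function on lists of arguments of arbitrary length, so that one function carries its
  components of all degrees, and inserting a vector field \<open>X\<close> is passing to \<open>\<lambda>zs. \<omega> (X # zs)\<close>. In terms of
  this insertion \<open>i\<^sub>X\<close>, the recursion is the commutation rule \<open>i\<^sub>Y \<L>\<^sub>X = \<L>\<^sub>X i\<^sub>Y - i\<^sub>V\<close>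
  with \<open>V = [X, Y]\<close>.
\<close>
fun lie_derivative ::
    "('a \<Rightarrow> 'a \<Rightarrow> 'a::ab_group_add) \<Rightarrow> ('a \<Rightarrow> 'a \<Rightarrow> 'a) \<Rightarrow> 'a \<Rightarrow> ('a list \<Rightarrow> 'a) \<Rightarrow> 'a list \<Rightarrow> 'a" where
  "lie_derivative act brk X \<omega> [] = act X (\<omega> [])"
| "lie_derivative act brk X \<omega> (Y # ys) =
     lie_derivative act brk X (\<lambda>zs. \<omega> (Y # zs)) ys - \<omega> (brk X Y # ys)"

text \<open>
  Cartan's formula \<open>i\<^sub>X d = \<L>\<^sub>X - d i\<^sub>X\<close>, read as a recursive definition of the Chevalley--Eilenberg
  differential. The component of degree zero, on the empty list, is zero since no form is mapped there.
\<close>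
fun cartan_d ::
    "('a \<Rightarrow> 'a \<Rightarrow> 'a::ab_group_add) \<Rightarrow> ('a \<Rightarrow> 'a \<Rightarrow> 'a) \<Rightarrow> ('a list \<Rightarrow> 'a) \<Rightarrow> 'a list \<Rightarrow> 'a" where
  "cartan_d act brk \<omega> [] = 0"
| "cartan_d act brk \<omega> (X # xs) =
     lie_derivative act brk X \<omega> xs - cartan_d act brk (\<lambda>zs. \<omega> (X # zs)) xs"

text \<open>
  Skew-symmetry under adjacent transpositions, in every degree at once: the set is then closed under
  insertion without any bookkeeping of degrees.
\<close>
definition skew_forms :: "'a::ab_group_add set \<Rightarrow> ('a list \<Rightarrow> 'a) set" where
  "skew_forms G = {\<omega>. \<forall>us vs. set us \<subseteq> G \<and> set vs \<subseteq> G \<longrightarrow>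
     \<omega> vs \<in> G \<and>
     (\<forall>a\<in>G. \<forall>b\<in>G. \<omega> (us @ (a + b) # vs) = \<omega> (us @ a # vs) + \<omega> (us @ b # vs) \<and>
                    \<omega> (us @ a # b # vs) = - \<omega> (us @ b # a # vs))}"

lemma skew_formsI:
  assumes "\<And>xs. set xs \<subseteq> G \<Longrightarrow> \<omega> xs \<in> G"
    and "\<And>us vs a b. set us \<subseteq> G \<Longrightarrow> set vs \<subseteq> G \<Longrightarrow> a \<in> G \<Longrightarrow> b \<in> G \<Longrightarrow>
           \<omega> (us @ (a + b) # vs) = \<omega> (us @ a # vs) + \<omega> (us @ b # vs)"
    and "\<And>us vs a b. set us \<subseteq> G \<Longrightarrow> set vs \<subseteq> G \<Longrightarrow> a \<in> G \<Longrightarrow> b \<in> G \<Longrightarrow>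
           \<omega> (us @ a # b # vs) = - \<omega> (us @ b # a # vs)"
  shows "\<omega> \<in> skew_forms G"
  using assms unfolding skew_forms_def by blast

lemma skew_formsD:
  assumes "\<omega> \<in> skew_forms G"
  shows "set xs \<subseteq> G \<Longrightarrow> \<omega> xs \<in> G"
    and "set us \<subseteq> G \<Longrightarrow> set vs \<subseteq> G \<Longrightarrow> a \<in> G \<Longrightarrow> b \<in> G \<Longrightarrow>
           \<omega> (us @ (a + b) # vs) = \<omega> (us @ a # vs) + \<omega> (us @ b # vs)"
    and "set us \<subseteq> G \<Longrightarrow> set vs \<subseteq> G \<Longrightarrow> a \<in> G \<Longrightarrow> b \<in> G \<Longrightarrow>
           \<omega> (us @ a # b # vs) = - \<omega> (us @ b # a # vs)"
  using assms unfolding skew_forms_def by blast+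

lemma skew_forms_hd:
  assumes "\<omega> \<in> skew_forms G" "set vs \<subseteq> G" "a \<in> G" "b \<in> G"
  shows "\<omega> ((a + b) # vs) = \<omega> (a # vs) + \<omega> (b # vs)"
    and "\<omega> (a # b # vs) = - \<omega> (b # a # vs)"
  using skew_formsD(2,3)[OF assms(1), of "[]" vs a b] assms by simp_all

lemma skew_forms_Cons:
  assumes "\<omega> \<in> skew_forms G" "X \<in> G"
  shows "(\<lambda>zs. \<omega> (X # zs)) \<in> skew_forms G"
proof (rule skew_formsI)
  fix us vs :: "'a list" and a b
  assume "set us \<subseteq> G" "set vs \<subseteq> G" "a \<in> G" "b \<in> G"
  then show "\<omega> (X # us @ (a + b) # vs) = \<omega> (X # us @ a # vs) + \<omega> (X # us @ b # vs)"
    "\<omega> (X # us @ a # b # vs) = - \<omega> (X # us @ b # a # vs)"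
    using skew_formsD(2,3)[OF assms(1), of "X # us" vs a b] assms(2) by simp_all
qed (simp add: skew_formsD(1)[OF assms(1)] assms(2))

locale bracket_action = additive_subgroup G
  for G :: "'a::ab_group_add set" +
  fixes act brk :: "'a \<Rightarrow> 'a \<Rightarrow> 'a"
  assumes act: "biadditive_on G act"
    and brk: "biadditive_on G brk"
    and brk_skew: "X \<in> G \<Longrightarrow> Y \<in> G \<Longrightarrow> brk X Y = - brk Y X"
begin

lemmas act_simps [simp] = biadditive_onD[OF act]
lemmas brk_simps [simp] = biadditive_onD[OF brk]

abbreviation "lder \<equiv> lie_derivative act brk"
abbreviation "cd \<equiv> cartan_d act brk"

lemma lder_cong:
  assumes "\<And>ys. set ys \<subseteq> G \<Longrightarrow> \<omega> ys = \<eta> ys" "set xs \<subseteq> G" "X \<in> G"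
  shows "lder X \<omega> xs = lder X \<eta> xs"
  using assms(1,2)
proof (induction xs arbitrary: \<omega> \<eta>)
  case (Cons Y xs)
  have "lder X (\<lambda>zs. \<omega> (Y # zs)) xs = lder X (\<lambda>zs. \<eta> (Y # zs)) xs"
    using Cons.prems by (intro Cons.IH) auto
  then show ?case using Cons.prems assms(3) by simp
qed simp

lemma cd_cong:
  assumes "\<And>ys. set ys \<subseteq> G \<Longrightarrow> \<omega> ys = \<eta> ys" "set xs \<subseteq> G"
  shows "cd \<omega> xs = cd \<eta> xs"
  using assms
proof (induction xs arbitrary: \<omega> \<eta>)
  case (Cons X xs)
  have "cd (\<lambda>zs. \<omega> (X # zs)) xs = cd (\<lambda>zs. \<eta> (X # zs)) xs"
    using Cons.prems by (intro Cons.IH) auto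
  moreover have "lder X \<omega> xs = lder X \<eta> xs"
    using Cons.prems by (intro lder_cong) auto
  ultimately show ?case by simp
qed simp

lemma lder_closed:
  assumes "\<And>ys. set ys \<subseteq> G \<Longrightarrow> \<omega> ys \<in> G" "set xs \<subseteq> G" "X \<in> G"
  shows "lder X \<omega> xs \<in> G"
  using assms by (induction xs arbitrary: \<omega>) auto

lemma cd_closed:
  assumes "\<And>ys. set ys \<subseteq> G \<Longrightarrow> \<omega> ys \<in> G" "set xs \<subseteq> G"
  shows "cd \<omega> xs \<in> G"
  using assms by (induction xs arbitrary: \<omega>) (auto intro!: diff_closed lder_closed)

lemma lder_diff:
  assumes "\<And>ys. set ys \<subseteq> G \<Longrightarrow> \<omega> ys \<in> G" "\<And>ys. set ys \<subseteq> G \<Longrightarrow> \<eta> ys \<in> G" "set xs \<subseteq> G" "X \<in> G"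
  shows "lder X (\<lambda>ys. \<omega> ys - \<eta> ys) xs = lder X \<omega> xs - lder X \<eta> xs"
  using assms by (induction xs arbitrary: \<omega> \<eta>) auto

lemma lder_add:
  assumes "\<And>ys. set ys \<subseteq> G \<Longrightarrow> \<omega> ys \<in> G" "\<And>ys. set ys \<subseteq> G \<Longrightarrow> \<eta> ys \<in> G" "set xs \<subseteq> G" "X \<in> G"
  shows "lder X (\<lambda>ys. \<omega> ys + \<eta> ys) xs = lder X \<omega> xs + lder X \<eta> xs"
  using assms by (induction xs arbitrary: \<omega> \<eta>) auto

lemma lder_minus:
  assumes "\<And>ys. set ys \<subseteq> G \<Longrightarrow> \<omega> ys \<in> G" "set xs \<subseteq> G" "X \<in> G"
  shows "lder X (\<lambda>ys. - \<omega> ys) xs = - lder X \<omega> xs"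
  using assms by (induction xs arbitrary: \<omega>) auto

lemma cd_diff:
  assumes "\<And>ys. set ys \<subseteq> G \<Longrightarrow> \<omega> ys \<in> G" "\<And>ys. set ys \<subseteq> G \<Longrightarrow> \<eta> ys \<in> G" "set xs \<subseteq> G"
  shows "cd (\<lambda>ys. \<omega> ys - \<eta> ys) xs = cd \<omega> xs - cd \<eta> xs"
  using assms by (induction xs arbitrary: \<omega> \<eta>) (auto simp: lder_diff)

lemma cd_add:
  assumes "\<And>ys. set ys \<subseteq> G \<Longrightarrow> \<omega> ys \<in> G" "\<And>ys. set ys \<subseteq> G \<Longrightarrow> \<eta> ys \<in> G" "set xs \<subseteq> G"
  shows "cd (\<lambda>ys. \<omega> ys + \<eta> ys) xs = cd \<omega> xs + cd \<eta> xs"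
  using assms by (induction xs arbitrary: \<omega> \<eta>) (auto simp: lder_add)

lemma cd_minus:
  assumes "\<And>ys. set ys \<subseteq> G \<Longrightarrow> \<omega> ys \<in> G" "set xs \<subseteq> G"
  shows "cd (\<lambda>ys. - \<omega> ys) xs = - cd \<omega> xs"
  using assms by (induction xs arbitrary: \<omega>) (auto simp: lder_minus)

text \<open>
  The first entry of the list is peeled off until the position in question comes first; there the
  recursive definition of the operator shows the claim. The same induction proves \<open>cd_skew_forms\<close>.
\<close>
lemma lder_skew_forms:
  assumes "\<omega> \<in> skew_forms G" "X \<in> G"
  shows "lder X \<omega> \<in> skew_forms G"
proof (rule skew_formsI)
  show "lder X \<omega> xs \<in> G" if "set xs \<subseteq> G" for xs
    using that assms(2) by (intro lder_closed) (auto intro: skew_formsD(1)[OF assms(1)])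
next
  fix us vs a b
  assume "set us \<subseteq> G" "set vs \<subseteq> G" "a \<in> G" "b \<in> G"
  then show "lder X \<omega> (us @ (a + b) # vs) = lder X \<omega> (us @ a # vs) + lder X \<omega> (us @ b # vs)"
    using assms(1)
  proof (induction us arbitrary: \<omega>)
    case Nil
    have "lder X (\<lambda>zs. \<omega> ((a + b) # zs)) vs = lder X (\<lambda>zs. \<omega> (a # zs) + \<omega> (b # zs)) vs"
      using Nil assms(2) by (intro lder_cong) (auto simp: skew_forms_hd(1))
    also have "\<dots> = lder X (\<lambda>zs. \<omega> (a # zs)) vs + lder X (\<lambda>zs. \<omega> (b # zs)) vs"
      using Nil assms(2) by (intro lder_add) (auto simp: skew_formsD(1))
    finally show ?case
      using Nil assms(2) by (simp add: skew_forms_hd(1))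
  next
    case (Cons u us)
    show ?case
      using Cons.IH[of "\<lambda>zs. \<omega> (u # zs)"] Cons.prems assms(2)
        skew_formsD(2)[OF Cons.prems(5), of "brk X u # us" vs a b]
      by (simp add: skew_forms_Cons)
  qed
next
  fix us vs a b
  assume "set us \<subseteq> G" "set vs \<subseteq> G" "a \<in> G" "b \<in> G"
  then show "lder X \<omega> (us @ a # b # vs) = - lder X \<omega> (us @ b # a # vs)"
    using assms(1)
  proof (induction us arbitrary: \<omega>)
    case Nil
    have "lder X (\<lambda>zs. \<omega> (a # b # zs)) vs = lder X (\<lambda>zs. - \<omega> (b # a # zs)) vs"
      using Nil assms(2) by (intro lder_cong) (auto simp: skew_forms_hd(2)[of _ _ _ a b])
    also have "\<dots> = - lder X (\<lambda>zs. \<omega> (b # a # zs)) vs"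
      using Nil assms(2) by (intro lder_minus) (auto simp: skew_formsD(1))
    finally show ?case
      using Nil assms(2) skew_forms_hd(2)[OF Nil(5,2), of "brk X a" b]
        skew_forms_hd(2)[OF Nil(5,2), of "brk X b" a]
      by simp
  next
    case (Cons u us)
    show ?case
      using Cons.IH[of "\<lambda>zs. \<omega> (u # zs)"] Cons.prems assms(2)
        skew_formsD(3)[OF Cons.prems(5), of "brk X u # us" vs a b]
      by (simp add: skew_forms_Cons)
  qed
qed

lemma lder_add_left:
  assumes "\<omega> \<in> skew_forms G" "X \<in> G" "Y \<in> G" "set xs \<subseteq> G"
  shows "lder (X + Y) \<omega> xs = lder X \<omega> xs + lder Y \<omega> xs"
  using assms(1,4)
proof (induction xs arbitrary: \<omega>)
  case Nil
  then show ?case using assms(2,3) by (simp add: skew_formsD(1))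
next
  case (Cons Z xs)
  then show ?case
    using assms(2,3) by (simp add: skew_forms_Cons skew_forms_hd(1))
qed

lemma cd_skew_forms:
  assumes "\<omega> \<in> skew_forms G"
  shows "cd \<omega> \<in> skew_forms G"
proof (rule skew_formsI)
  show "cd \<omega> xs \<in> G" if "set xs \<subseteq> G" for xs
    using that by (intro cd_closed) (auto intro: skew_formsD(1)[OF assms(1)])
next
  fix us vs a b
  assume "set us \<subseteq> G" "set vs \<subseteq> G" "a \<in> G" "b \<in> G"
  then show "cd \<omega> (us @ (a + b) # vs) = cd \<omega> (us @ a # vs) + cd \<omega> (us @ b # vs)"
    using assms(1)
  proof (induction us arbitrary: \<omega>)
    case Nil
    have "cd (\<lambda>zs. \<omega> ((a + b) # zs)) vs = cd (\<lambda>zs. \<omega> (a # zs) + \<omega> (b # zs)) vs"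
      using Nil by (intro cd_cong) (auto simp: skew_forms_hd(1))
    also have "\<dots> = cd (\<lambda>zs. \<omega> (a # zs)) vs + cd (\<lambda>zs. \<omega> (b # zs)) vs"
      using Nil by (intro cd_add) (auto simp: skew_formsD(1))
    finally show ?case
      using Nil by (simp add: lder_add_left)
  next
    case (Cons u us)
    show ?case
      using Cons.IH[of "\<lambda>zs. \<omega> (u # zs)"] Cons.prems
        skew_formsD(2)[OF lder_skew_forms[OF Cons.prems(5), of u], of us vs a b]
      by (simp add: skew_forms_Cons)
  qed
next
  fix us vs a b
  assume "set us \<subseteq> G" "set vs \<subseteq> G" "a \<in> G" "b \<in> G"
  then show "cd \<omega> (us @ a # b # vs) = - cd \<omega> (us @ b # a # vs)"
    using assms(1)
  proof (induction us arbitrary: \<omega>)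
    case Nil
    have "cd (\<lambda>zs. \<omega> (a # b # zs)) vs = cd (\<lambda>zs. - \<omega> (b # a # zs)) vs"
      using Nil by (intro cd_cong) (auto simp: skew_forms_hd(2)[of _ _ _ a b])
    also have "\<dots> = - cd (\<lambda>zs. \<omega> (b # a # zs)) vs"
      using Nil by (intro cd_minus) (auto simp: skew_formsD(1))
    moreover have "\<omega> (brk a b # vs) = - \<omega> (brk b a # vs)"
    proof -
      have "brk a b + brk b a = 0"
        using Nil brk_skew[of a b] by simp
      moreover have "\<omega> ((brk a b + brk b a) # vs) = \<omega> (brk a b # vs) + \<omega> (brk b a # vs)"
        using Nil by (intro skew_forms_hd(1)) auto
      moreover have "\<omega> ((0 + 0) # vs) = \<omega> (0 # vs) + \<omega> (0 # vs)"
        using Nil by (intro skew_forms_hd(1)) auto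
      ultimately show ?thesis
        by (simp only: eq_neg_iff_add_eq_0) simp
    qed
    ultimately show ?case by simp
  next
    case (Cons u us)
    show ?case
      using Cons.IH[of "\<lambda>zs. \<omega> (u # zs)"] Cons.prems
        skew_formsD(3)[OF lder_skew_forms[OF Cons.prems(5), of u], of us vs a b]
      by (simp add: skew_forms_Cons)
  qed
qed

end

locale lie_representation = bracket_action +
  assumes jacobi: "X \<in> G \<Longrightarrow> Y \<in> G \<Longrightarrow> Z \<in> G \<Longrightarrow> brk X (brk Y Z) = brk (brk X Y) Z + brk Y (brk X Z)"
    and representation: "X \<in> G \<Longrightarrow> Y \<in> G \<Longrightarrow> Z \<in> G \<Longrightarrow> act (brk X Y) Z = act X (act Y Z) - act Y (act X Z)"
begin

lemma lder_Cons_eq: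
  "(\<lambda>zs. lder X \<omega> (Y # zs)) = (\<lambda>zs. lder X (\<lambda>zs. \<omega> (Y # zs)) zs - \<omega> (brk X Y # zs))"
  by simp

lemma cd_Cons_eq:
  "(\<lambda>zs. cd \<omega> (X # zs)) = (\<lambda>zs. lder X \<omega> zs - cd (\<lambda>zs. \<omega> (X # zs)) zs)"
  by simp

text \<open>
  On the empty list this is the representation property of the action; peeling off one argument, the
  commutators with insertions leave a defect which is the Jacobi identity.
\<close>
lemma lder_bracket:
  assumes "\<omega> \<in> skew_forms G" "X \<in> G" "Y \<in> G" "set xs \<subseteq> G"
  shows "lder (brk X Y) \<omega> xs = lder X (lder Y \<omega>) xs - lder Y (lder X \<omega>) xs"
  using assms(1,4)
proof (induction xs arbitrary: \<omega>)
  case Nil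
  then show ?case using assms(2,3) by (simp add: skew_formsD(1) representation)
next
  case (Cons Z xs)
  have *: "lder A (\<lambda>zs. lder B \<omega> (Z # zs)) xs =
      lder A (lder B (\<lambda>zs. \<omega> (Z # zs))) xs - lder A (\<lambda>zs. \<omega> (brk B Z # zs)) xs"
    if "A \<in> G" "B \<in> G" for A B
    unfolding lder_Cons_eq using Cons.prems that
    by (intro lder_diff) (auto intro!: lder_closed skew_formsD(1)[OF Cons.prems(1)])
  have "\<omega> (brk X (brk Y Z) # xs) = \<omega> (brk (brk X Y) Z # xs) + \<omega> (brk Y (brk X Z) # xs)"
    using Cons.prems assms(2,3) by (simp add: jacobi[of X Y Z] skew_forms_hd(1))
  then show ?case
    using Cons.IH[of "\<lambda>zs. \<omega> (Z # zs)"] Cons.prems assms(2,3) *[of X Y] *[of Y X]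
    by (simp del: lie_derivative.simps(2) add: skew_forms_Cons lie_derivative.simps(2)[of act brk _ _ Z]
      lie_derivative.simps(2)[of act brk _ _ "brk _ Z"])
qed

text \<open>
  Inserting \<open>Y\<close> on both sides and using Cartan's formula turns the claim into
  \<open>\<L>\<^sub>X \<L>\<^sub>Y - \<L>\<^sub>V = \<L>\<^sub>Y \<L>\<^sub>X\<close> with \<open>V = [X, Y]\<close>, up to the claim for \<open>i\<^sub>Y \<omega>\<close>.
\<close>
lemma lder_cd_commute:
  assumes "\<omega> \<in> skew_forms G" "X \<in> G" "set xs \<subseteq> G"
  shows "lder X (cd \<omega>) xs = cd (lder X \<omega>) xs"
  using assms(1,3)
proof (induction xs arbitrary: \<omega>)
  case Nil
  then show ?case using assms(2) by (simp add: skew_formsD(1))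
next
  case (Cons Y xs)
  note [intro] = lder_closed cd_closed skew_formsD(1)[OF Cons.prems(1)]
  have Y: "Y \<in> G" "set xs \<subseteq> G" using Cons.prems by auto
  have "lder X (cd \<omega>) (Y # xs) = lder X (\<lambda>zs. cd \<omega> (Y # zs)) xs - cd \<omega> (brk X Y # xs)"
    by simp
  also have "lder X (\<lambda>zs. cd \<omega> (Y # zs)) xs =
      lder X (lder Y \<omega>) xs - lder X (cd (\<lambda>zs. \<omega> (Y # zs))) xs"
    unfolding cd_Cons_eq using Y assms(2)
    by (intro lder_diff) (auto intro!: cd_closed[of "\<lambda>zs. \<omega> (Y # zs)"] skew_formsD(1)[OF Cons.prems(1)])
  also have "lder X (cd (\<lambda>zs. \<omega> (Y # zs))) xs = cd (lder X (\<lambda>zs. \<omega> (Y # zs))) xs"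
    using Cons.IH Y Cons.prems by (simp add: skew_forms_Cons)
  also have "cd \<omega> (brk X Y # xs) =
      lder X (lder Y \<omega>) xs - lder Y (lder X \<omega>) xs - cd (\<lambda>zs. \<omega> (brk X Y # zs)) xs"
    using lder_bracket Cons.prems assms(2) by simp
  finally have lhs: "lder X (cd \<omega>) (Y # xs) = lder Y (lder X \<omega>) xs -
      (cd (lder X (\<lambda>zs. \<omega> (Y # zs))) xs - cd (\<lambda>zs. \<omega> (brk X Y # zs)) xs)"
    by (simp add: algebra_simps)
  have "cd (\<lambda>zs. lder X \<omega> (Y # zs)) xs =
      cd (lder X (\<lambda>zs. \<omega> (Y # zs))) xs - cd (\<lambda>zs. \<omega> (brk X Y # zs)) xs"
    unfolding lder_Cons_eq using Y assms(2)
    by (intro cd_diff) (auto intro!: lder_closed[of "\<lambda>zs. \<omega> (Y # zs)"] skew_formsD(1)[OF Cons.prems(1)])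
  then show ?case using lhs by simp
qed

text \<open>
  \<open>i\<^sub>X d d = \<L>\<^sub>X d - d i\<^sub>X d = \<L>\<^sub>X d - d \<L>\<^sub>X + d d i\<^sub>X\<close>, where the first two terms cancel and the last vanishes by
  induction.
\<close>
lemma cd_square:
  assumes "\<omega> \<in> skew_forms G" "set xs \<subseteq> G"
  shows "cd (cd \<omega>) xs = 0"
  using assms
proof (induction xs arbitrary: \<omega>)
  case (Cons X xs)
  note [intro] = lder_closed cd_closed skew_formsD(1)[OF Cons.prems(1)]
  have X: "X \<in> G" "set xs \<subseteq> G" using Cons.prems by auto
  have "cd (\<lambda>zs. cd \<omega> (X # zs)) xs = cd (lder X \<omega>) xs - cd (cd (\<lambda>zs. \<omega> (X # zs))) xs"
    unfolding cd_Cons_eq using X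
    by (intro cd_diff) (auto intro!: cd_closed[of "\<lambda>zs. \<omega> (X # zs)"] skew_formsD(1)[OF Cons.prems(1)])
  also have "cd (cd (\<lambda>zs. \<omega> (X # zs))) xs = 0"
    using Cons.IH X Cons.prems by (simp add: skew_forms_Cons)
  finally show ?case
    using lder_cd_commute[OF Cons.prems(1) X] by simp
qed simp

end

text \<open>The scalar \<open>(-1)\<^sup>i\<close>, acting on an abelian group.\<close>
definition signed :: "nat \<Rightarrow> 'a::ab_group_add \<Rightarrow> 'a" where
  "signed i x = (if even i then x else - x)"

text \<open>The explicit formula for the differential, on one fixed space of sections.\<close>
definition koszul ::
    "('a \<Rightarrow> 'a \<Rightarrow> 'a::ab_group_add) \<Rightarrow> ('a \<Rightarrow> 'a \<Rightarrow> 'a) \<Rightarrow> ('a list \<Rightarrow> 'a) \<Rightarrow> 'a list \<Rightarrow> 'a" where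
  "koszul act brk \<omega> xs =
     (\<Sum>i<length xs. signed i (act (xs ! i) (\<omega> (remove_nth i xs)))) +
     (\<Sum>j<length xs. \<Sum>i<j. signed (i + j)
        (\<omega> (brk (xs ! i) (xs ! j) # remove_nth i (remove_nth j xs))))"

lemma signed_Suc [simp]: "signed (Suc i) x = - signed i x"
  by (simp add: signed_def)

lemma signed_0 [simp]: "signed 0 x = x"
  by (simp add: signed_def)

lemma signed_minus [simp]: "signed i (- x) = - signed i x"
  by (simp add: signed_def)

lemma remove_nth_Cons [simp]:
  "remove_nth 0 (x # xs) = xs" "remove_nth (Suc i) (x # xs) = x # remove_nth i xs"
  by (simp_all add: remove_nth_def)

lemma set_remove_nth: "set (remove_nth i xs) \<subseteq> set xs"
  by (auto simp: remove_nth_def dest: in_set_takeD in_set_dropD)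

lemma length_remove_nth: "i < length xs \<Longrightarrow> length (remove_nth i xs) = length xs - 1"
  by (simp add: remove_nth_def)

lemma skew_forms_move:
  assumes "\<omega> \<in> skew_forms G" "set us \<subseteq> G" "set vs \<subseteq> G" "v \<in> G"
  shows "\<omega> (us @ v # vs) = signed (length us) (\<omega> (v # us @ vs))"
  using assms(1,2)
proof (induction us arbitrary: \<omega>)
  case (Cons u us)
  then show ?case
    using assms(3,4) skew_forms_hd(2)[OF Cons.prems(1), of "us @ vs" u v]
      Cons.IH[of "\<lambda>zs. \<omega> (u # zs)"]
    by (simp add: skew_forms_Cons)
qed simp

lemma skew_forms_update:
  assumes "\<omega> \<in> skew_forms G" "set xs \<subseteq> G" "v \<in> G" "i < length xs"
  shows "\<omega> (xs[i := v]) = signed i (\<omega> (v # remove_nth i xs))"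
  using skew_forms_move[OF assms(1), of "take i xs" "drop (Suc i) xs" v] assms
  by (auto simp: upd_conv_take_nth_drop remove_nth_def dest: in_set_takeD in_set_dropD)

text \<open>The Lie derivative in closed form, as needed to recognise it inside Koszul's formula.\<close>
lemma lie_derivative_sum:
  "lie_derivative act brk X \<omega> xs = act X (\<omega> xs) - (\<Sum>i<length xs. \<omega> (xs[i := brk X (xs ! i)]))"
proof (induction xs arbitrary: \<omega>)
  case (Cons Y ys)
  show ?case
    by (simp add: Cons sum.lessThan_Suc_shift del: sum.lessThan_Suc)
qed simp

context bracket_action
begin

text \<open>
  Koszul's formula satisfies Cartan's recursion: the summands that involve the first argument \<open>X\<close> add up
  to the Lie derivative, after moving each bracket \<open>[X, X\<^sub>i]\<close> back from the first position to position \<open>i\<close>;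
  in the others \<open>X\<close> is a spectator, and the sign comes from the index shift in the first sum and from the
  exchange of \<open>X\<close> with a bracket in the second.
\<close>
lemma koszul_Cons:
  assumes "\<omega> \<in> skew_forms G" "X \<in> G" "set xs \<subseteq> G"
  shows "koszul act brk \<omega> (X # xs) = lder X \<omega> xs - koszul act brk (\<lambda>zs. \<omega> (X # zs)) xs"
proof -
  let ?n = "length xs"
  have x: "xs ! i \<in> G" if "i < ?n" for i using that assms(3) by auto
  have first: "(\<Sum>i<Suc ?n. signed i (act ((X # xs) ! i) (\<omega> (remove_nth i (X # xs))))) =
      act X (\<omega> xs) - (\<Sum>i<?n. signed i (act (xs ! i) (\<omega> (X # remove_nth i xs))))"
    by (simp add: sum.lessThan_Suc_shift sum_negf del: sum.lessThan_Suc)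
  have swap: "\<omega> (brk (xs ! i) (xs ! j) # X # remove_nth i (remove_nth j xs)) =
      - \<omega> (X # brk (xs ! i) (xs ! j) # remove_nth i (remove_nth j xs))" if "i < j" "j < ?n" for i j
    using assms x that set_remove_nth[of i "remove_nth j xs"] set_remove_nth[of j xs]
    by (intro skew_forms_hd(2)) auto
  have "(\<Sum>j<Suc ?n. \<Sum>i<j. signed (i + j)
        (\<omega> (brk ((X # xs) ! i) ((X # xs) ! j) # remove_nth i (remove_nth j (X # xs))))) =
      (\<Sum>j<?n. - signed j (\<omega> (brk X (xs ! j) # remove_nth j xs))) +
      (\<Sum>j<?n. \<Sum>i<j. signed (i + j) (\<omega> (brk (xs ! i) (xs ! j) # X # remove_nth i (remove_nth j xs))))"
    by (simp add: sum.lessThan_Suc_shift sum_subtractf sum_negf del: sum.lessThan_Suc)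
  also have "(\<Sum>j<?n. - signed j (\<omega> (brk X (xs ! j) # remove_nth j xs))) =
      - (\<Sum>j<?n. \<omega> (xs[j := brk X (xs ! j)]))"
    unfolding sum_negf[symmetric] using assms x by (intro sum.cong) (auto simp: skew_forms_update)
  also have "(\<Sum>j<?n. \<Sum>i<j. signed (i + j) (\<omega> (brk (xs ! i) (xs ! j) # X # remove_nth i (remove_nth j xs)))) =
      - (\<Sum>j<?n. \<Sum>i<j. signed (i + j) (\<omega> (X # brk (xs ! i) (xs ! j) # remove_nth i (remove_nth j xs))))"
    unfolding sum_negf[symmetric] using swap by (intro sum.cong) auto
  finally show ?thesis
    using first by (simp add: koszul_def lie_derivative_sum del: sum.lessThan_Suc)
qed

lemma koszul_eq_cd:
  assumes "\<omega> \<in> skew_forms G" "set xs \<subseteq> G"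
  shows "koszul act brk \<omega> xs = cd \<omega> xs"
  using assms
proof (induction xs arbitrary: \<omega>)
  case Nil
  then show ?case by (simp add: koszul_def)
next
  case (Cons X xs)
  then show ?case by (simp add: koszul_Cons skew_forms_Cons)
qed

lemma koszul_cong:
  assumes "\<And>ys. set ys \<subseteq> G \<Longrightarrow> Suc (length ys) = length xs \<Longrightarrow> \<omega> ys = \<eta> ys" "set xs \<subseteq> G"
  shows "koszul act brk \<omega> xs = koszul act brk \<eta> xs"
proof -
  have x: "xs ! i \<in> G" if "i < length xs" for i using that assms(2) by auto
  have "\<omega> (remove_nth i xs) = \<eta> (remove_nth i xs)" if "i < length xs" for i
    using that assms(2) set_remove_nth[of i xs] by (intro assms(1)) (auto simp: length_remove_nth)
  moreover have "\<omega> (brk (xs ! i) (xs ! j) # remove_nth i (remove_nth j xs)) =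
      \<eta> (brk (xs ! i) (xs ! j) # remove_nth i (remove_nth j xs))" if "i < j" "j < length xs" for i j
    using that assms(2) x set_remove_nth[of i "remove_nth j xs"] set_remove_nth[of j xs]
    by (intro assms(1)) (auto simp: length_remove_nth)
  ultimately show ?thesis
    unfolding koszul_def by (intro arg_cong2[of _ _ _ _ plus] sum.cong) auto
qed

end

text \<open>
  Koszul's formula in degree \<open>k\<close> sees only the component of degree \<open>k\<close> of a form. So a form given in one
  degree only may be extended by zero to all others, which makes it a member of \<open>skew_forms\<close>.
\<close>
lemma koszul_koszul:
  assumes "bracket_action G act brk" "bracket_action G act' brk'"
    and \<omega>: "(\<lambda>xs. if length xs = k then \<omega> xs else 0) \<in> skew_forms G" (is "?\<omega> \<in> _")
    and xs: "set xs \<subseteq> G" "length xs = k + 2"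
  shows "koszul act' brk' (koszul act brk \<omega>) xs = cartan_d act' brk' (cartan_d act brk ?\<omega>) xs"
proof -
  interpret a: bracket_action G act brk by fact
  interpret b: bracket_action G act' brk' by fact
  have "koszul act' brk' (koszul act brk \<omega>) xs = koszul act' brk' (koszul act brk ?\<omega>) xs"
    using xs by (intro b.koszul_cong a.koszul_cong) auto
  also have "\<dots> = koszul act' brk' (cartan_d act brk ?\<omega>) xs"
    using xs \<omega> by (intro b.koszul_cong a.koszul_eq_cd) auto
  also have "\<dots> = cartan_d act' brk' (cartan_d act brk ?\<omega>) xs"
    using xs \<omega> by (intro b.koszul_eq_cd a.cd_skew_forms) auto
  finally show ?thesis .
qed

lemma lie_derivative_sum_structure:
  assumes "bracket_action G act brk" "bracket_action G act' brk'"
    and "\<omega> \<in> skew_forms G" "X \<in> G" "set xs \<subseteq> G"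
  shows "lie_derivative (\<lambda>X Z. act X Z + act' X Z) (\<lambda>X Y. brk X Y + brk' X Y) X \<omega> xs =
    lie_derivative act brk X \<omega> xs + lie_derivative act' brk' X \<omega> xs"
proof -
  interpret a: bracket_action G act brk by fact
  interpret b: bracket_action G act' brk' by fact
  show ?thesis
    using assms(3,5)
  proof (induction xs arbitrary: \<omega>)
    case (Cons Y ys)
    then show ?case
      using assms(4) by (simp add: skew_forms_Cons skew_forms_hd(1))
  qed simp
qed

lemma cartan_d_sum_structure:
  assumes "bracket_action G act brk" "bracket_action G act' brk'"
    and "\<omega> \<in> skew_forms G" "set xs \<subseteq> G"
  shows "cartan_d (\<lambda>X Z. act X Z + act' X Z) (\<lambda>X Y. brk X Y + brk' X Y) \<omega> xs =
    cartan_d act brk \<omega> xs + cartan_d act' brk' \<omega> xs"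
  using assms(3,4)
proof (induction xs arbitrary: \<omega>)
  case (Cons Y ys)
  then show ?case
    using lie_derivative_sum_structure[OF assms(1,2) Cons.prems(1), of Y ys] by (simp add: skew_forms_Cons)
qed simp

text \<open>
  The differential is additive in the pair of action and bracket, so this is the polarisation of
  \<open>d\<^sup>2 = 0\<close>, applied to both structures and to their sum.
\<close>
lemma cartan_d_anticommute:
  assumes 1: "lie_representation G act brk" and 2: "lie_representation G act' brk'"
    and 3: "lie_representation G (\<lambda>X Z. act X Z + act' X Z) (\<lambda>X Y. brk X Y + brk' X Y)"
    and \<omega>: "\<omega> \<in> skew_forms G" and xs: "set xs \<subseteq> G"
  shows "cartan_d act brk (cartan_d act' brk' \<omega>) xs + cartan_d act' brk' (cartan_d act brk \<omega>) xs = 0"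
proof -
  interpret a: lie_representation G act brk by fact
  interpret b: lie_representation G act' brk' by fact
  interpret c: lie_representation G "\<lambda>X Z. act X Z + act' X Z" "\<lambda>X Y. brk X Y + brk' X Y" by fact
  note split = cartan_d_sum_structure[OF a.bracket_action_axioms b.bracket_action_axioms]
  have "0 = c.cd (c.cd \<omega>) xs"
    using c.cd_square[OF \<omega> xs] by simp
  also have "\<dots> = c.cd (\<lambda>ys. a.cd \<omega> ys + b.cd \<omega> ys) xs"
    using \<omega> xs split by (intro c.cd_cong) auto
  also have "\<dots> = c.cd (a.cd \<omega>) xs + c.cd (b.cd \<omega>) xs"
    using \<omega> xs by (intro c.cd_add a.cd_closed b.cd_closed) (auto simp: skew_formsD(1))
  also have "\<dots> = a.cd (b.cd \<omega>) xs + b.cd (a.cd \<omega>) xs"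
    using \<omega> xs split[OF a.cd_skew_forms[OF \<omega>] xs] split[OF b.cd_skew_forms[OF \<omega>] xs]
    by (simp add: a.cd_square b.cd_square)
  finally show ?thesis by simp
qed

text \<open>
  As the Nijenhuis torsion of \<open>N\<close> vanishes, the deformed double bracket can be expanded so that inside a
  bracket \<open>N\<close> is applied to one of the three arguments only; then every group of terms with the same arguments and the same outer power of \<open>N\<close> is an
  instance of the original Jacobi identity.
\<close>
lemma (in lie_representation) deformed_jacobi:
  fixes N :: "'a \<Rightarrow> 'a"
  assumes N [simp]: "\<And>X. X \<in> G \<Longrightarrow> N X \<in> G"
    and N_add: "\<And>X Y. X \<in> G \<Longrightarrow> Y \<in> G \<Longrightarrow> N (X + Y) = N X + N Y"
  defines "tw \<equiv> \<lambda>X Y. brk (N X) Y + brk X (N Y) - N (brk X Y)"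
  assumes nijenhuis: "\<And>X Y. X \<in> G \<Longrightarrow> Y \<in> G \<Longrightarrow> N (tw X Y) = brk (N X) (N Y)"
    and [simp]: "X \<in> G" "Y \<in> G" "Z \<in> G"
  shows "tw X (tw Y Z) = tw (tw X Y) Z + tw Y (tw X Z)"
proof -
  have tw: "tw A B = brk (N A) B + brk A (N B) - N (brk A B)" for A B
    by (simp add: tw_def)
  have N0: "N 0 = 0" using N_add[of 0 0] by simp
  have N_minus: "N (- U) = - N U" if "U \<in> G" for U
    using N_add[of U "- U"] that N0 by (simp add: eq_neg_iff_add_eq_0 add.commute)
  have N_diff: "N (U - V) = N U - N V" if "U \<in> G" "V \<in> G" for U V
    using N_add[of U "- V"] that by (simp add: N_minus)
  note N_simps = N_add N_diff N_minus
  have expand: "tw A (tw B C) = brk (N A) (brk (N B) C) + brk (N A) (brk B (N C)) + brk A (brk (N B) (N C))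
      - N (brk (N A) (brk B C)) - N (brk A (brk (N B) C)) - N (brk A (brk B (N C))) + N (N (brk A (brk B C)))"
    if [simp]: "A \<in> G" "B \<in> G" "C \<in> G" for A B C
  proof -
    have "tw A (tw B C) = brk (N A) (tw B C) + brk A (N (tw B C)) - N (brk A (tw B C))"
      by (simp add: tw[of A])
    also have "brk A (N (tw B C)) = brk A (brk (N B) (N C))"
      by (simp add: nijenhuis)
    also have "brk (N A) (tw B C) = brk (N A) (brk (N B) C) + brk (N A) (brk B (N C)) - brk (N A) (N (brk B C))"
      by (simp add: tw_def)
    also have "brk (N A) (N (brk B C)) = N (brk (N A) (brk B C)) + N (brk A (N (brk B C))) - N (N (brk A (brk B C)))"
      using nijenhuis[of A "brk B C"] by (simp add: tw_def N_simps)
    also have "N (brk A (tw B C)) = N (brk A (brk (N B) C)) + N (brk A (brk B (N C))) - N (brk A (N (brk B C)))"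
      by (simp add: tw_def N_simps)
    finally show ?thesis by (simp add: algebra_simps)
  qed
  have tw_closed [simp]: "tw A B \<in> G" if "A \<in> G" "B \<in> G" for A B
    using that by (simp add: tw_def)
  have "tw A B = - tw B A" if "A \<in> G" "B \<in> G" for A B
  proof -
    have "brk (N A) B = - brk B (N A)" "brk A (N B) = - brk (N B) A" "brk A B = - brk B A"
      using that by (auto intro: brk_skew)
    then show ?thesis
      using that by (simp only: tw) (simp add: N_minus)
  qed
  from this[of "tw X Y" Z] have skew: "tw (tw X Y) Z = - tw Z (tw X Y)"
    by simp
  have jac: "brk A (brk B C) = brk B (brk A C) - brk C (brk A B)"
    if [simp]: "A \<in> G" "B \<in> G" "C \<in> G" for A B C
  proof -
    have "brk (brk A B) C = - brk C (brk A B)"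
      by (rule brk_skew) simp_all
    then show ?thesis
      by (simp add: jacobi[OF that])
  qed
  show ?thesis
    unfolding skew expand[OF \<open>X \<in> G\<close> \<open>Y \<in> G\<close> \<open>Z \<in> G\<close>] expand[OF \<open>Y \<in> G\<close> \<open>X \<in> G\<close> \<open>Z \<in> G\<close>]
      expand[OF \<open>Z \<in> G\<close> \<open>X \<in> G\<close> \<open>Y \<in> G\<close>]
    by (simp add: jac[of X Y Z] jac[of X Y "N Z"] jac[of X "N Y" Z] jac[of "N X" Y Z]
      jac[of "N X" "N Y" Z] jac[of "N X" Y "N Z"] jac[of X "N Y" "N Z"] N_simps)
qed

lemma lie_representation_cong:
  assumes "lie_representation G act brk"
    and act_eq: "\<And>X Z. X \<in> G \<Longrightarrow> Z \<in> G \<Longrightarrow> act' X Z = act X Z"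
    and brk_eq: "\<And>X Z. X \<in> G \<Longrightarrow> Z \<in> G \<Longrightarrow> brk' X Z = brk X Z"
  shows "lie_representation G act' brk'"
proof -
  interpret lie_representation G act brk by fact
  show ?thesis
  proof
    show "biadditive_on G act'" "biadditive_on G brk'"
      by (auto simp: biadditive_on_def act_eq brk_eq)
    show "brk' X Y = - brk' Y X" if "X \<in> G" "Y \<in> G" for X Y
      using brk_skew[OF that] brk_eq that by metis
    show "brk' X (brk' Y Z) = brk' (brk' X Y) Z + brk' Y (brk' X Z)"
      "act' (brk' X Y) Z = act' X (act' Y Z) - act' Y (act' X Z)" if "X \<in> G" "Y \<in> G" "Z \<in> G" for X Y Z
      using that jacobi[OF that] representation[OF that] by (simp_all add: act_eq brk_eq)
  qed
qed

text \<open>On forms of degree zero, the composition of two differentials has the shape of a curvature.\<close>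
lemma koszul_koszul_0:
  "koszul act brk (koszul act' brk' \<omega>) [X, Y] =
     act X (act' Y (\<omega> [])) - act Y (act' X (\<omega> [])) - act' (brk X Y) (\<omega> [])"
  by (simp add: koszul_def remove_nth_def signed_def)

section \<open>Torsionless connections on commutative algebras\<close>

text \<open>A commutative product with unit, together with a connection without torsion for the bracket.\<close>
locale torsionless_algebra = additive_subgroup G
  for G :: "'a::ab_group_add set" +
  fixes p :: "'a \<Rightarrow> 'a \<Rightarrow> 'a" (infixl \<open>\<odot>\<close> 70) and D br :: "'a \<Rightarrow> 'a \<Rightarrow> 'a" and e :: 'a
  assumes p: "biadditive_on G (\<odot>)"
    and D: "biadditive_on G D"
    and br_eq: "X \<in> G \<Longrightarrow> Y \<in> G \<Longrightarrow> br X Y = D X Y - D Y X"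
    and p_comm: "X \<in> G \<Longrightarrow> Y \<in> G \<Longrightarrow> X \<odot> Y = Y \<odot> X"
    and p_assoc: "X \<in> G \<Longrightarrow> Y \<in> G \<Longrightarrow> Z \<in> G \<Longrightarrow> X \<odot> Y \<odot> Z = X \<odot> (Y \<odot> Z)"
    and e_closed [simp]: "e \<in> G"
    and p_unit [simp]: "X \<in> G \<Longrightarrow> e \<odot> X = X"
begin

lemmas p_simps [simp] = biadditive_onD[OF p]
lemmas D_simps [simp] = biadditive_onD[OF D]

lemma p_left_comm: "X \<in> G \<Longrightarrow> Y \<in> G \<Longrightarrow> Z \<in> G \<Longrightarrow> X \<odot> (Y \<odot> Z) = Y \<odot> (X \<odot> Z)"
  by (metis p_assoc p_comm)

lemmas p_ac = p_assoc p_comm p_left_comm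

lemma p_unit_right [simp]: "X \<in> G \<Longrightarrow> X \<odot> e = X"
  by (simp add: p_comm[of X e])

definition curvature :: "'a \<Rightarrow> 'a \<Rightarrow> 'a \<Rightarrow> 'a" where
  "curvature X Y Z = D X (D Y Z) - D Y (D X Z) - D (br X Y) Z"

text \<open>
  The exterior covariant derivative of the product, regarded as a one-form with values in
  endomorphisms. It vanishes if and only if the derivative of the product is totally symmetric.
\<close>
definition codazzi :: "'a \<Rightarrow> 'a \<Rightarrow> 'a \<Rightarrow> 'a" where
  "codazzi X Y Z = D X (Y \<odot> Z) - D Y (X \<odot> Z) - Y \<odot> D X Z + X \<odot> D Y Z - br X Y \<odot> Z"

definition hertling_manin :: "'a \<Rightarrow> 'a \<Rightarrow> 'a \<Rightarrow> 'a \<Rightarrow> 'a" where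
  "hertling_manin X Y Z W =
     br (X \<odot> Y) (W \<odot> Z) - br (X \<odot> Y) Z \<odot> W - br (X \<odot> Y) W \<odot> Z
     - X \<odot> br Y (Z \<odot> W) + X \<odot> (br Y Z \<odot> W) + X \<odot> (br Y W \<odot> Z)
     - Y \<odot> br X (Z \<odot> W) + Y \<odot> (br X Z \<odot> W) + Y \<odot> (br X W \<odot> Z)"

text \<open>The covariant derivative of the product.\<close>
definition deriv_p :: "'a \<Rightarrow> 'a \<Rightarrow> 'a \<Rightarrow> 'a" where
  "deriv_p X Y Z = D X (Y \<odot> Z) - D X Y \<odot> Z - Y \<odot> D X Z"

lemma deriv_p_closed [simp]: "X \<in> G \<Longrightarrow> Y \<in> G \<Longrightarrow> Z \<in> G \<Longrightarrow> deriv_p X Y Z \<in> G"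
  by (simp add: deriv_p_def)

lemma codazzi_eq:
  assumes [simp]: "X \<in> G" "Y \<in> G" "Z \<in> G"
  shows "codazzi X Y Z = deriv_p X Y Z - deriv_p Y X Z"
  by (simp add: codazzi_def deriv_p_def br_eq p_ac algebra_simps)

text \<open>The derivative of the associative law.\<close>
lemma deriv_p_assoc:
  assumes [simp]: "X \<in> G" "Y \<in> G" "Z \<in> G" "W \<in> G"
  shows "deriv_p X (Y \<odot> Z) W + W \<odot> deriv_p X Y Z = deriv_p X Y (Z \<odot> W) + Y \<odot> deriv_p X Z W"
  by (simp add: deriv_p_def p_ac algebra_simps)

text \<open>
  Replacing all brackets by commutators of \<open>D\<close>, the terms in which \<open>D\<close> differentiates a single argument
  cancel, and only derivatives of the product remain.
\<close>
lemma hertling_manin_eq: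
  assumes [simp]: "X \<in> G" "Y \<in> G" "Z \<in> G" "W \<in> G"
  shows "hertling_manin X Y Z W =
     deriv_p (X \<odot> Y) Z W - deriv_p (Z \<odot> W) X Y + W \<odot> deriv_p Z X Y + Z \<odot> deriv_p W X Y
     - X \<odot> deriv_p Y Z W - Y \<odot> deriv_p X Z W"
  by (simp add: hertling_manin_def deriv_p_def br_eq p_ac algebra_simps)

text \<open>
  If the derivative of the product is totally symmetric, then in the preceding formula all terms
  differentiate in the directions \<open>X\<close> and \<open>Z\<close>, and they cancel by the differentiated associative laws of
  \<open>X \<odot> Y \<odot> W\<close> and \<open>Z \<odot> W \<odot> Y\<close>.
\<close>
lemma hertling_manin_if_codazzi:
  assumes codazzi: "\<And>X Y Z. X \<in> G \<Longrightarrow> Y \<in> G \<Longrightarrow> Z \<in> G \<Longrightarrow> codazzi X Y Z = 0"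
    and [simp]: "X \<in> G" "Y \<in> G" "Z \<in> G" "W \<in> G"
  shows "hertling_manin X Y Z W = 0"
proof -
  have sym: "deriv_p A B C = deriv_p B A C" if "A \<in> G" "B \<in> G" "C \<in> G" for A B C
    using codazzi[OF that] codazzi_eq[OF that] by simp
  have 1: "deriv_p (X \<odot> Y) Z W = deriv_p Z (X \<odot> Y) W"
    by (simp add: sym[of "X \<odot> Y"])
  have 2: "deriv_p (Z \<odot> W) X Y = deriv_p X (Z \<odot> W) Y"
    by (simp add: sym[of "Z \<odot> W"])
  have 3: "deriv_p Z X (Y \<odot> W) = deriv_p X Z (W \<odot> Y)"
    by (simp add: sym[of Z X] p_comm[of Y W])
  have 4: "deriv_p Z Y W = deriv_p Y Z W" by (simp add: sym[of Z Y])
  have 5: "deriv_p X W Y = deriv_p W X Y" by (simp add: sym[of X W])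
  show ?thesis
    using deriv_p_assoc[of Z X Y W] deriv_p_assoc[of X Z W Y]
    unfolding hertling_manin_eq[OF assms(2-5)] 1 2 3 4 5
    by (simp add: algebra_simps)
qed

text \<open>
  This is about \<open>D - \<lambda>\<circ>\<close>. Multiplication by the constant \<open>\<lambda>\<close> is abstracted to an additive operator \<open>s\<close>
  that commutes with everything; the quadratic term in \<open>\<lambda>\<close> is a commutator of multiplications and
  vanishes.
\<close>
lemma curvature_shift:
  assumes s: "\<And>X. X \<in> G \<Longrightarrow> s X \<in> G"
    and s_p: "\<And>X Y. X \<in> G \<Longrightarrow> Y \<in> G \<Longrightarrow> s X \<odot> Y = s (X \<odot> Y)"
    and s_D: "\<And>X Y. X \<in> G \<Longrightarrow> Y \<in> G \<Longrightarrow> D (s X) Y = s (D X Y)" "\<And>X Y. X \<in> G \<Longrightarrow> Y \<in> G \<Longrightarrow> D X (s Y) = s (D X Y)"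
    and s_add: "\<And>X Y. X \<in> G \<Longrightarrow> Y \<in> G \<Longrightarrow> s (X + Y) = s X + s Y"
    and [simp]: "X \<in> G" "Y \<in> G" "Z \<in> G"
  defines "D' \<equiv> \<lambda>X Y. D X Y - s (X \<odot> Y)"
  shows "D' X (D' Y Z) - D' Y (D' X Z) - D' (br X Y) Z = curvature X Y Z - s (codazzi X Y Z)"
proof -
  have s0: "s 0 = 0" using s_add[of 0 0] by simp
  have s_minus: "s (- U) = - s U" if "U \<in> G" for U
    using s_add[of U "- U"] that s0 by (simp add: eq_neg_iff_add_eq_0 add.commute)
  have s_diff: "s (U - V) = s U - s V" if "U \<in> G" "V \<in> G" for U V
    using s_add[of U "- V"] that by (simp add: s_minus)
  have s_p2: "U \<odot> s V = s (U \<odot> V)" if "U \<in> G" "V \<in> G" for U V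
    using that s by (simp add: p_comm[of U] s_p)
  show ?thesis
    by (simp add: D'_def curvature_def codazzi_def br_eq s s_p s_p2 s_D s_add s_diff p_ac algebra_simps)
qed

end

lemma (in torsionless_algebra) br_biadditive: "biadditive_on G br"
  by (auto simp: biadditive_on_def br_eq)

text \<open>
  Without torsion, the Jacobi identity of the bracket is the first Bianchi identity, so it follows from
  flatness too.
\<close>
lemma (in torsionless_algebra) lie_representation_if_flat:
  assumes flat: "\<And>X Y Z. X \<in> G \<Longrightarrow> Y \<in> G \<Longrightarrow> Z \<in> G \<Longrightarrow> curvature X Y Z = 0"
  shows "lie_representation G D br"
proof
  have D_br: "D (br X Y) Z = D X (D Y Z) - D Y (D X Z)" if "X \<in> G" "Y \<in> G" "Z \<in> G" for X Y Z
    using flat[OF that] by (simp add: curvature_def)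
  then show "D (br X Y) Z = D X (D Y Z) - D Y (D X Z)" if "X \<in> G" "Y \<in> G" "Z \<in> G" for X Y Z
    using that by blast
  show "br X (br Y Z) = br (br X Y) Z + br Y (br X Z)" if [simp]: "X \<in> G" "Y \<in> G" "Z \<in> G" for X Y Z
  proof -
    have [simp]: "br U V \<in> G" if "U \<in> G" "V \<in> G" for U V
      using that by (simp add: br_eq)
    have iter: "br U (br V W) = D U (D V W) - D U (D W V) - D V (D W U) + D W (D V U)"
      if [simp]: "U \<in> G" "V \<in> G" "W \<in> G" for U V W
    proof -
      have "br U (br V W) = D U (br V W) - D (br V W) U"
        by (simp add: br_eq)
      also have "D U (br V W) = D U (D V W) - D U (D W V)"
        by (simp add: br_eq)
      also have "D (br V W) U = D V (D W U) - D W (D V U)"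
        by (simp add: D_br)
      finally show ?thesis by simp
    qed
    have skew: "br (br X Y) Z = - br Z (br X Y)"
      by (simp add: br_eq[of _ Z] br_eq[of Z])
    show ?thesis
      by (simp add: skew iter[of X Y Z] iter[of Y X Z] iter[of Z X Y])
  qed
qed (simp_all add: D br_biadditive br_eq)

section \<open>Euler elements and the dual structure\<close>

text \<open>The vector fields on an open subset of an F-manifold with Euler field \<open>E\<close> and \<open>De = 0\<close>.\<close>
locale euler_algebra = torsionless_algebra +
  fixes E :: 'a
  assumes hertling_manin: "X \<in> G \<Longrightarrow> Y \<in> G \<Longrightarrow> Z \<in> G \<Longrightarrow> W \<in> G \<Longrightarrow> hertling_manin X Y Z W = 0"
    and E_closed [simp]: "E \<in> G"

    and euler: "X \<in> G \<Longrightarrow> Y \<in> G \<Longrightarrow> br E (X \<odot> Y) - br E X \<odot> Y - X \<odot> br E Y = X \<odot> Y"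
    and D_unit [simp]: "X \<in> G \<Longrightarrow> D X e = 0"
begin

lemma br_closed [simp]: "X \<in> G \<Longrightarrow> Y \<in> G \<Longrightarrow> br X Y \<in> G"
  by (simp add: br_eq)

text \<open>
  Since \<open>e\<close> is parallel, \<open>D\<^sub>e Y = [e, Y]\<close>, and with the unit in the first two places the Hertling--Manin
  identity says that the Lie derivative along \<open>e\<close> of the product equals twice itself.
\<close>
lemma D_unit_left_Leibniz:
  assumes [simp]: "X \<in> G" "Y \<in> G"
  shows "D e (X \<odot> Y) = D e X \<odot> Y + X \<odot> D e Y"
  using hertling_manin[of e e X Y]
  by (simp add: hertling_manin_def br_eq p_ac algebra_simps)

definition twisted :: "'a \<Rightarrow> 'a \<Rightarrow> 'a" where
  "twisted X Y = br (E \<odot> X) Y + br X (E \<odot> Y) - E \<odot> br X Y"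

text \<open>
  The Nijenhuis torsion of \<open>E\<circ>\<close> is the Hertling--Manin expression of \<open>E, X, Y, E\<close>, corrected by the Euler
  property for the products \<open>E \<circ> X\<close> and \<open>E \<circ> Y\<close>.
\<close>
lemma nijenhuis:
  assumes [simp]: "X \<in> G" "Y \<in> G"
  shows "E \<odot> twisted X Y = br (E \<odot> X) (E \<odot> Y)"
proof -
  have "br (E \<odot> X) (E \<odot> Y) - E \<odot> twisted X Y = hertling_manin E X Y E
      + X \<odot> (br E (E \<odot> Y) - br E E \<odot> Y - E \<odot> br E Y - E \<odot> Y)
      - Y \<odot> (br E (E \<odot> X) - br E E \<odot> X - E \<odot> br E X - E \<odot> X)"
    by (simp add: twisted_def hertling_manin_def br_eq p_ac algebra_simps)
  then show ?thesis
    using hertling_manin[of E X Y E] euler[of E Y] euler[of E X] by simp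
qed

text \<open>The second covariant derivative of \<open>E\<close>.\<close>
definition hessian :: "'a \<Rightarrow> 'a \<Rightarrow> 'a" where
  "hessian X Y = D X (D Y E) - D (D X Y) E"

lemma hessian_closed [simp]: "X \<in> G \<Longrightarrow> Y \<in> G \<Longrightarrow> hessian X Y \<in> G"
  by (simp add: hessian_def)

end

text \<open>
  If multiplication by \<open>E\<close> is invertible, its inverse is multiplication by \<open>F = (E\<circ>)\<^sup>-\<^sup>1 e\<close>, so that the dual
  product is \<open>F \<circ> X \<circ> Y\<close> and all computations take place in one commutative ring.
\<close>
locale almost_dual = euler_algebra +
  fixes F :: 'a
  assumes F_closed [simp]: "F \<in> G"
    and E_F: "E \<odot> F = e"
begin

lemma E_F_cancel [simp]: "X \<in> G \<Longrightarrow> E \<odot> (F \<odot> X) = X" "X \<in> G \<Longrightarrow> F \<odot> (E \<odot> X) = X"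
  using p_assoc[of E F X] p_assoc[of F E X] p_comm[of F E] E_F by simp_all

definition star :: "'a \<Rightarrow> 'a \<Rightarrow> 'a" where
  "star X Y = F \<odot> (X \<odot> Y)"

definition dual_D :: "'a \<Rightarrow> 'a \<Rightarrow> 'a" where
  "dual_D X Y = D X Y - D (star X Y) E"

lemma star_E: "X \<in> G \<Longrightarrow> Y \<in> G \<Longrightarrow> star (E \<odot> X) Y = X \<odot> Y" "X \<in> G \<Longrightarrow> Y \<in> G \<Longrightarrow> star X (E \<odot> Y) = X \<odot> Y"
  by (simp_all add: star_def p_left_comm[of X E Y] p_assoc[of E X Y])

lemma star_closed [simp]: "X \<in> G \<Longrightarrow> Y \<in> G \<Longrightarrow> star X Y \<in> G"
  by (simp add: star_def)

text \<open>One factor \<open>E\<close>, in either argument, removes the inverse of \<open>E\<close> from the dual connection.\<close>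
lemma dual_D_E:
  assumes [simp]: "X \<in> G" "Y \<in> G"
  shows "dual_D (E \<odot> X) Y = D (E \<odot> X) Y - D (X \<odot> Y) E" "dual_D X (E \<odot> Y) = D X (E \<odot> Y) - D (X \<odot> Y) E"
  by (simp_all add: dual_D_def star_E)

lemma star_biadditive: "biadditive_on G star"
  by (auto simp: biadditive_on_def star_def)

lemma dual_D_biadditive: "biadditive_on G dual_D"
  by (auto simp: biadditive_on_def dual_D_def biadditive_onD[OF star_biadditive])

lemma star_dual: "torsionless_algebra G star dual_D br E"
proof
  show "star X Y = star Y X" if "X \<in> G" "Y \<in> G" for X Y
    using that by (simp add: star_def p_comm)
  then show "br X Y = dual_D X Y - dual_D Y X" if "X \<in> G" "Y \<in> G" for X Y
    using that by (simp add: dual_D_def br_eq)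
  show "star (star X Y) Z = star X (star Y Z)" if "X \<in> G" "Y \<in> G" "Z \<in> G" for X Y Z
    using that by (simp add: star_def p_ac)
  show "star E X = X" if "X \<in> G" for X
    using that by (simp add: star_def)
qed (use star_biadditive dual_D_biadditive in auto)

sublocale dual: torsionless_algebra G star dual_D br E
  by (rule star_dual)

text \<open>
  The anticommutator of the two differentials on a form of degree zero, that is on the vector field \<open>Z\<close>.
\<close>
definition mixed :: "'a \<Rightarrow> 'a \<Rightarrow> 'a \<Rightarrow> 'a" where
  "mixed X Y Z = D X (dual_D (E \<odot> Y) Z) - D Y (dual_D (E \<odot> X) Z) - dual_D (E \<odot> br X Y) Z
     + dual_D (E \<odot> X) (D Y Z) - dual_D (E \<odot> Y) (D X Z) - D (twisted X Y) Z"

text \<open>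
  Since \<open>[X, Y]\<^sub>L + L [X, Y] = [L X, Y] + [X, L Y]\<close>, the terms free of \<open>DE\<close> are exactly two curvatures of
  \<open>D\<close>; completing the second-order terms to second covariant derivatives of \<open>E\<close> leaves the derivative of \<open>E\<close> in the
  direction of \<open>codazzi X Y Z\<close>.
\<close>
lemma mixed_eq:
  assumes [simp]: "X \<in> G" "Y \<in> G" "Z \<in> G"
  shows "mixed X Y Z = curvature (E \<odot> X) Y Z + curvature X (E \<odot> Y) Z
     - hessian X (Y \<odot> Z) + hessian Y (X \<odot> Z) - D (codazzi X Y Z) E"
  by (simp add: mixed_def curvature_def codazzi_def hessian_def twisted_def dual_D_E br_eq algebra_simps)

text \<open>
  The case \<open>X = e\<close> shows that the Hessian of \<open>E\<close> factors through the product, so the terms with the Hessian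
  cancel in general, and the injectivity of \<open>DE\<close> applies to what is left.
\<close>
lemma codazzi_if_mixed:
  assumes flat: "\<And>X Y Z. X \<in> G \<Longrightarrow> Y \<in> G \<Longrightarrow> Z \<in> G \<Longrightarrow> curvature X Y Z = 0"
    and mixed: "\<And>X Y Z. X \<in> G \<Longrightarrow> Y \<in> G \<Longrightarrow> Z \<in> G \<Longrightarrow> mixed X Y Z = 0"
    and inj: "\<And>X. X \<in> G \<Longrightarrow> D X E = 0 \<Longrightarrow> X = 0"
    and [simp]: "X \<in> G" "Y \<in> G" "Z \<in> G"
  shows "codazzi X Y Z = 0"
proof -
  have eq: "D (codazzi A B C) E = hessian B (A \<odot> C) - hessian A (B \<odot> C)"
    if "A \<in> G" "B \<in> G" "C \<in> G" for A B C
    using mixed[OF that] mixed_eq[OF that] flat[of "E \<odot> A" B C] flat[of A "E \<odot> B" C] that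
    by (simp add: algebra_simps)
  have hess: "hessian A B = hessian e (A \<odot> B)" if [simp]: "A \<in> G" "B \<in> G" for A B
  proof -
    have "codazzi e A B = 0"
      by (simp add: codazzi_def br_eq D_unit_left_Leibniz p_ac algebra_simps)
    then show ?thesis
      using eq[of e A B] by simp
  qed
  have "hessian Y (X \<odot> Z) = hessian X (Y \<odot> Z)"
    by (simp add: hess[of Y] hess[of X] p_left_comm)
  then have "D (codazzi X Y Z) E = 0"
    by (simp add: eq)
  then show ?thesis
    by (rule inj[rotated]) (simp add: codazzi_def br_eq)
qed

context
  assumes codazzi: "\<And>X Y Z. X \<in> G \<Longrightarrow> Y \<in> G \<Longrightarrow> Z \<in> G \<Longrightarrow> codazzi X Y Z = 0"
begin

text \<open>
  The key formula of almost duality. The total symmetry of \<open>D\<circ>\<close> exchanges the derivative of \<open>E \<circ> W\<close> along \<open>X\<close>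
  for one of \<open>X \<circ> W\<close> along \<open>E\<close>, which the Euler property evaluates. The last summand has the form
  \<open>X \<circ> V\<close>; therefore, \<open>*\<close>-multiplied by another vector field \<open>Y\<close>, it is symmetric in \<open>X\<close> and \<open>Y\<close>.
\<close>
lemma dual_D_mult_E:
  assumes [simp]: "X \<in> G" "W \<in> G"
  shows "dual_D X (E \<odot> W) = E \<odot> D X W + X \<odot> (W - D W E)"
proof -
  have "dual_D X (E \<odot> W) - E \<odot> D X W - X \<odot> (W - D W E) =
      codazzi X E W + (br E (X \<odot> W) - br E X \<odot> W - X \<odot> br E W - X \<odot> W)"
    by (simp add: dual_D_E codazzi_def br_eq p_ac algebra_simps)
  then show ?thesis
    using codazzi[of X E W] euler[of X W] by (simp add: algebra_simps)
qed

lemma star_dual_D: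
  assumes [simp]: "X \<in> G" "Y \<in> G" "W \<in> G"
  shows "star X (dual_D Y (E \<odot> W)) = X \<odot> D Y W + F \<odot> (X \<odot> (Y \<odot> (W - D W E)))"
  unfolding dual_D_mult_E[OF assms(2,3)] using star_E(2)[of X "D Y W"] by (simp add: star_def)

text \<open>
  Writing \<open>Z = E \<circ> W\<close>, the symmetric summands of \<open>star_dual_D\<close> cancel, and what is left is \<open>codazzi\<close> for \<open>W\<close>.
\<close>
lemma dual_codazzi:
  assumes [simp]: "X \<in> G" "Y \<in> G" "Z \<in> G"
  shows "dual.codazzi X Y Z = 0"
proof -
  define W where "W = F \<odot> Z"
  have [simp]: "W \<in> G" and Z: "Z = E \<odot> W" by (simp_all add: W_def)
  have dual_D_diff: "dual_D X (Y \<odot> W) - dual_D Y (X \<odot> W) = D X (Y \<odot> W) - D Y (X \<odot> W)"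
    by (simp add: dual_D_def star_def p_left_comm[of X Y])
  have "dual.codazzi X Y Z = codazzi X Y W"
    unfolding dual.codazzi_def Z star_E(2)[OF assms(1) \<open>W \<in> G\<close>] star_E(2)[OF assms(2) \<open>W \<in> G\<close>]
      star_E(2)[OF br_closed[OF assms(1,2)] \<open>W \<in> G\<close>] star_dual_D[OF assms(1,2) \<open>W \<in> G\<close>] star_dual_D[OF assms(2,1) \<open>W \<in> G\<close>] dual_D_diff codazzi_def
    by (simp add: p_left_comm[of X Y])
  then show ?thesis using codazzi by simp
qed

text \<open>
  In \<open>D\<^sup>*\<^sub>X D\<^sup>*\<^sub>Y (E \<circ> Z)\<close> both descriptions of the dual connection are used: the definition for the derivative
  along \<open>X\<close>, and \<open>star_dual_D\<close> for its correction term. Up to curvatures of \<open>D\<close>, antisymmetrisation gives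
  the formula of \<open>mixed_eq\<close>.
\<close>
lemma dual_curvature_eq_mixed:
  assumes flat: "\<And>X Y Z. X \<in> G \<Longrightarrow> Y \<in> G \<Longrightarrow> Z \<in> G \<Longrightarrow> curvature X Y Z = 0"
    and [simp]: "X \<in> G" "Y \<in> G" "Z \<in> G"
  shows "dual.curvature X Y (E \<odot> Z) = mixed X Y Z"
proof -
  have *: "dual_D A (dual_D B (E \<odot> Z)) = D A (D B (E \<odot> Z) - D (B \<odot> Z) E)
      - D (A \<odot> D B Z) E - D (F \<odot> (A \<odot> (B \<odot> (Z - D Z E)))) E"
    if [simp]: "A \<in> G" "B \<in> G" for A B
  proof -
    have "star A (dual_D B (E \<odot> Z)) = A \<odot> D B Z + F \<odot> (A \<odot> (B \<odot> (Z - D Z E)))"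
      by (rule star_dual_D) simp_all
    then have "dual_D A (dual_D B (E \<odot> Z)) = D A (dual_D B (E \<odot> Z))
        - D (A \<odot> D B Z + F \<odot> (A \<odot> (B \<odot> (Z - D Z E)))) E"
      by (simp only: dual_D_def[of A])
    then show ?thesis
      by (simp add: dual_D_E)
  qed
  have "dual.curvature X Y (E \<odot> Z) = curvature X Y (E \<odot> Z)
      - hessian X (Y \<odot> Z) + hessian Y (X \<odot> Z) - D (codazzi X Y Z) E"
    unfolding dual.curvature_def *[OF assms(2,3)] *[OF assms(3,2)] dual_D_E(2)[OF br_closed[OF assms(2,3)] assms(4)]
    by (simp add: curvature_def hessian_def codazzi_def p_left_comm[of X Y] algebra_simps)
  then show ?thesis
    by (simp add: mixed_eq flat)
qed

end

end

context almost_dual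
begin

lemma twisted_biadditive: "biadditive_on G twisted"
  by (auto simp: biadditive_on_def twisted_def biadditive_onD[OF br_biadditive])

lemma twisted_closed [simp]: "X \<in> G \<Longrightarrow> Y \<in> G \<Longrightarrow> twisted X Y \<in> G"
  by (simp add: twisted_def)

text \<open>
  As \<open>L [X, Y]\<^sub>L = [L X, L Y]\<close>, the action of \<open>X\<close> as \<open>D\<^sup>*\<close> in the direction \<open>L X\<close> is the pullback
  of \<open>D\<^sup>*\<close> along \<open>L\<close>.
\<close>
lemma dual_representation_eq:
  assumes [simp]: "X \<in> G" "Y \<in> G" "Z \<in> G"
  shows "dual_D (E \<odot> X) (dual_D (E \<odot> Y) Z) - dual_D (E \<odot> Y) (dual_D (E \<odot> X) Z)
    - dual_D (E \<odot> twisted X Y) Z = dual.curvature (E \<odot> X) (E \<odot> Y) Z"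
  by (simp add: dual.curvature_def nijenhuis)

context
  assumes flat: "\<And>X Y Z. X \<in> G \<Longrightarrow> Y \<in> G \<Longrightarrow> Z \<in> G \<Longrightarrow> curvature X Y Z = 0"
begin

interpretation L: lie_representation G D br
  by (rule lie_representation_if_flat) (rule flat)

lemma twisted_skew: "X \<in> G \<Longrightarrow> Y \<in> G \<Longrightarrow> twisted X Y = - twisted Y X"
  by (simp add: twisted_def br_eq algebra_simps)

lemma lie_representation_dual:
  assumes dual_flat: "\<And>X Y Z. X \<in> G \<Longrightarrow> Y \<in> G \<Longrightarrow> Z \<in> G \<Longrightarrow> dual.curvature X Y Z = 0"
  shows "lie_representation G (\<lambda>X Z. dual_D (E \<odot> X) Z) twisted"
proof
  show "twisted X (twisted Y Z) = twisted (twisted X Y) Z + twisted Y (twisted X Z)"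
    if "X \<in> G" "Y \<in> G" "Z \<in> G" for X Y Z
    using L.deformed_jacobi[of "\<lambda>X. E \<odot> X", OF _ _ _ that] nijenhuis
    by (simp add: twisted_def)
  show "dual_D (E \<odot> twisted X Y) Z =
      dual_D (E \<odot> X) (dual_D (E \<odot> Y) Z) - dual_D (E \<odot> Y) (dual_D (E \<odot> X) Z)"
    if "X \<in> G" "Y \<in> G" "Z \<in> G" for X Y Z
    using that dual_representation_eq[OF that] dual_flat[of "E \<odot> X" "E \<odot> Y" Z] by simp
qed (auto simp: biadditive_on_def biadditive_onD[OF twisted_biadditive] intro: twisted_skew)

text \<open>
  The sum of the two brackets is the bracket deformed by \<open>I + L\<close>, which has the same Nijenhuis torsion as
  \<open>L\<close>; the cross terms in the representation property are \<open>mixed\<close>.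
\<close>
lemma lie_representation_sum:
  assumes dual_flat: "\<And>X Y Z. X \<in> G \<Longrightarrow> Y \<in> G \<Longrightarrow> Z \<in> G \<Longrightarrow> dual.curvature X Y Z = 0"
    and mixed: "\<And>X Y Z. X \<in> G \<Longrightarrow> Y \<in> G \<Longrightarrow> Z \<in> G \<Longrightarrow> mixed X Y Z = 0"
  shows "lie_representation G (\<lambda>X Z. D X Z + dual_D (E \<odot> X) Z) (\<lambda>X Y. br X Y + twisted X Y)"
proof
  interpret M: lie_representation G "\<lambda>X Z. dual_D (E \<odot> X) Z" twisted
    by (rule lie_representation_dual) (rule dual_flat)
  let ?N = "\<lambda>X. X + E \<odot> X"
  have tw: "br (?N X) Y + br X (?N Y) - ?N (br X Y) = br X Y + twisted X Y" if "X \<in> G" "Y \<in> G" for X Y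
    using that by (simp add: twisted_def)
  show "br X (br Y Z + twisted Y Z) + twisted X (br Y Z + twisted Y Z) =
      br (br X Y + twisted X Y) Z + twisted (br X Y + twisted X Y) Z +
      (br Y (br X Z + twisted X Z) + twisted Y (br X Z + twisted X Z))"
    if "X \<in> G" "Y \<in> G" "Z \<in> G" for X Y Z
    using L.deformed_jacobi[of ?N, OF _ _ _ that] nijenhuis that
    by (simp add: tw) (simp add: twisted_def algebra_simps)
  show "D (br X Y + twisted X Y) Z + dual_D (E \<odot> (br X Y + twisted X Y)) Z =
      D X (D Y Z + dual_D (E \<odot> Y) Z) + dual_D (E \<odot> X) (D Y Z + dual_D (E \<odot> Y) Z) -
      (D Y (D X Z + dual_D (E \<odot> X) Z) + dual_D (E \<odot> Y) (D X Z + dual_D (E \<odot> X) Z))"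
    if [simp]: "X \<in> G" "Y \<in> G" "Z \<in> G" for X Y Z
    using mixed[OF that] L.representation[OF that] M.representation[OF that]
    by (simp add: mixed_def algebra_simps)
  show "br X Y + twisted X Y = - (br Y X + twisted Y X)" if "X \<in> G" "Y \<in> G" for X Y
    using that L.brk_skew[OF that] twisted_skew[OF that] by simp
qed (auto simp: biadditive_on_def biadditive_onD[OF twisted_biadditive] algebra_simps)

end

end

section \<open>Sections of the tangent sheaf\<close>

lemma fun_minus_eq: "(- f) = (\<lambda>x. - f x)"
  by (simp add: fun_eq_iff)

locale function_sheaf_space =
  fixes \<O> :: "'p::topological_space set \<Rightarrow> ('p \<Rightarrow> 'k::real_normed_field) set"
  assumes sheaf: "function_sheaf \<O>"
begin

abbreviation "VF \<equiv> vector_fields \<O>"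

lemma
  assumes "open V"
  shows supp: "f \<in> \<O> V \<Longrightarrow> restrict_fun V f = f"
    and cont: "f \<in> \<O> V \<Longrightarrow> continuous_on V f"
    and const_mem: "restrict_fun V (\<lambda>_. c) \<in> \<O> V"
    and add_mem: "f \<in> \<O> V \<Longrightarrow> g \<in> \<O> V \<Longrightarrow> f + g \<in> \<O> V"
    and mult_mem: "f \<in> \<O> V \<Longrightarrow> g \<in> \<O> V \<Longrightarrow> f * g \<in> \<O> V"
    and restrict_mem: "f \<in> \<O> V \<Longrightarrow> open W \<Longrightarrow> W \<subseteq> V \<Longrightarrow> restrict_fun W f \<in> \<O> W"
proof -
  note s = sheaf[unfolded function_sheaf_def, THEN spec, THEN mp, OF assms]
  note s1 = s[THEN conjunct1] and s2 = s[THEN conjunct2]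
  note s3 = s2[THEN conjunct2] note s4 = s3[THEN conjunct2]
  show "f \<in> \<O> V \<Longrightarrow> restrict_fun V f = f" "f \<in> \<O> V \<Longrightarrow> continuous_on V f"
    using s1 by simp_all
  show "restrict_fun V (\<lambda>_. c) \<in> \<O> V"
    by (rule s2[THEN conjunct1, THEN spec])
  show "f \<in> \<O> V \<Longrightarrow> g \<in> \<O> V \<Longrightarrow> f + g \<in> \<O> V" "f \<in> \<O> V \<Longrightarrow> g \<in> \<O> V \<Longrightarrow> f * g \<in> \<O> V"
    using s3[THEN conjunct1] by simp_all
  show "f \<in> \<O> V \<Longrightarrow> open W \<Longrightarrow> W \<subseteq> V \<Longrightarrow> restrict_fun W f \<in> \<O> W"
    using s4[THEN conjunct1] by simp
qed

lemma supp_outside: "open V \<Longrightarrow> f \<in> \<O> V \<Longrightarrow> x \<notin> V \<Longrightarrow> f x = 0"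
  using supp[of V f] by (metis restrict_fun_def)

lemma zero_mem: "open V \<Longrightarrow> 0 \<in> \<O> V"
  using const_mem[of V 0] by (simp add: restrict_fun_def zero_fun_def)

lemma scaled_mem: "(\<lambda>x. c * f x) \<in> \<O> V" if "open V" "f \<in> \<O> V"
proof -
  have "restrict_fun V (\<lambda>_. c) * f \<in> \<O> V"
    using that by (intro mult_mem const_mem)
  moreover have "restrict_fun V (\<lambda>_. c) * f = (\<lambda>x. c * f x)"
    using supp_outside[OF that] by (auto simp: restrict_fun_def fun_eq_iff)
  ultimately show ?thesis by simp
qed

lemma minus_mem: "- f \<in> \<O> V" if "open V" "f \<in> \<O> V"
  using scaled_mem[OF that, of "-1"] by (simp add: fun_minus_eq)

lemma diff_mem: "open V \<Longrightarrow> f \<in> \<O> V \<Longrightarrow> g \<in> \<O> V \<Longrightarrow> f - g \<in> \<O> V"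
  using add_mem[of V f "- g"] minus_mem[of V g] by simp

lemma VF_I:
  assumes "\<And>W f. \<not> (open W \<and> W \<subseteq> V \<and> f \<in> \<O> W) \<Longrightarrow> X W f = 0"
    and "\<And>W f. open W \<Longrightarrow> W \<subseteq> V \<Longrightarrow> f \<in> \<O> W \<Longrightarrow> X W f \<in> \<O> W"
    and "\<And>W f c. open W \<Longrightarrow> W \<subseteq> V \<Longrightarrow> f \<in> \<O> W \<Longrightarrow> X W (\<lambda>x. c * f x) = (\<lambda>x. c * X W f x)"
    and "\<And>W f g. open W \<Longrightarrow> W \<subseteq> V \<Longrightarrow> f \<in> \<O> W \<Longrightarrow> g \<in> \<O> W \<Longrightarrow> X W (f + g) = X W f + X W g"
    and "\<And>W f g. open W \<Longrightarrow> W \<subseteq> V \<Longrightarrow> f \<in> \<O> W \<Longrightarrow> g \<in> \<O> W \<Longrightarrow> X W (f * g) = f * X W g + g * X W f"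
    and "\<And>W W' f. open W \<Longrightarrow> W \<subseteq> V \<Longrightarrow> f \<in> \<O> W \<Longrightarrow> open W' \<Longrightarrow> W' \<subseteq> W \<Longrightarrow>
           X W' (restrict_fun W' f) = restrict_fun W' (X W f)"
  shows "X \<in> VF V"
  unfolding vector_fields_def mem_Collect_eq
  by (intro conjI allI impI ballI) (blast intro: assms)+

lemma
  assumes "X \<in> VF V"
  shows vf_supp: "\<not> (open W \<and> W \<subseteq> V \<and> f \<in> \<O> W) \<Longrightarrow> X W f = 0"
    and vf_mem: "open W \<Longrightarrow> W \<subseteq> V \<Longrightarrow> f \<in> \<O> W \<Longrightarrow> X W f \<in> \<O> W"
    and vf_const: "open W \<Longrightarrow> W \<subseteq> V \<Longrightarrow> f \<in> \<O> W \<Longrightarrow> X W (\<lambda>x. c * f x) = (\<lambda>x. c * X W f x)"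
    and vf_add: "open W \<Longrightarrow> W \<subseteq> V \<Longrightarrow> f \<in> \<O> W \<Longrightarrow> g \<in> \<O> W \<Longrightarrow> X W (f + g) = X W f + X W g"
    and vf_mult: "open W \<Longrightarrow> W \<subseteq> V \<Longrightarrow> f \<in> \<O> W \<Longrightarrow> g \<in> \<O> W \<Longrightarrow> X W (f * g) = f * X W g + g * X W f"
    and vf_restrict: "open W \<Longrightarrow> W \<subseteq> V \<Longrightarrow> f \<in> \<O> W \<Longrightarrow> open W' \<Longrightarrow> W' \<subseteq> W \<Longrightarrow>
           X W' (restrict_fun W' f) = restrict_fun W' (X W f)"
proof -
  note v = assms[unfolded vector_fields_def mem_Collect_eq]
  show "\<not> (open W \<and> W \<subseteq> V \<and> f \<in> \<O> W) \<Longrightarrow> X W f = 0"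
    by (rule v[THEN conjunct1, THEN spec, THEN spec, THEN mp])
  note w = v[THEN conjunct2, THEN spec, THEN mp, OF conjI, THEN bspec]
  show "open W \<Longrightarrow> W \<subseteq> V \<Longrightarrow> f \<in> \<O> W \<Longrightarrow> X W f \<in> \<O> W"
    by (rule w[THEN conjunct1])
  note w2 = w[THEN conjunct2]
  show "open W \<Longrightarrow> W \<subseteq> V \<Longrightarrow> f \<in> \<O> W \<Longrightarrow> X W (\<lambda>x. c * f x) = (\<lambda>x. c * X W f x)"
    by (rule w2[THEN conjunct1, THEN spec])
  note w3 = w2[THEN conjunct2]
  show "open W \<Longrightarrow> W \<subseteq> V \<Longrightarrow> f \<in> \<O> W \<Longrightarrow> g \<in> \<O> W \<Longrightarrow> X W (f + g) = X W f + X W g"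
    by (rule w3[THEN conjunct1, THEN bspec, THEN conjunct1])
  show "open W \<Longrightarrow> W \<subseteq> V \<Longrightarrow> f \<in> \<O> W \<Longrightarrow> g \<in> \<O> W \<Longrightarrow> X W (f * g) = f * X W g + g * X W f"
    by (rule w3[THEN conjunct1, THEN bspec, THEN conjunct2])
  show "open W \<Longrightarrow> W \<subseteq> V \<Longrightarrow> f \<in> \<O> W \<Longrightarrow> open W' \<Longrightarrow> W' \<subseteq> W \<Longrightarrow>
      X W' (restrict_fun W' f) = restrict_fun W' (X W f)"
    by (rule w3[THEN conjunct2, THEN spec, THEN mp, OF _ _ _ conjI])
qed

lemma vf_outside: "X W f x = 0" if "X \<in> VF V" "x \<notin> W"
proof (cases "open W \<and> W \<subseteq> V \<and> f \<in> \<O> W")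
  case True
  then show ?thesis using vf_mem[OF that(1)] supp_outside[of W "X W f"] that(2) by blast
next
  case False
  then show ?thesis using vf_supp[OF that(1) False] by simp
qed

lemma vf_zero: "X W 0 = 0" if "X \<in> VF V"
proof (cases "open W \<and> W \<subseteq> V")
  case True
  then show ?thesis
    using vf_const[OF that, of W 0 0] zero_mem[of W] by (simp add: zero_fun_def)
next
  case False
  then show ?thesis using vf_supp[OF that] by blast
qed

text \<open>The product rule for \<open>1 = 1 * 1\<close>.\<close>
lemma vf_constant: "X V (restrict_fun V (\<lambda>_. c)) = 0" if "X \<in> VF V" "open V"
proof -
  let ?u = "restrict_fun V (\<lambda>_. 1::'k)"
  have u: "?u \<in> \<O> V" using that by (intro const_mem)
  have "?u * ?u = ?u"
    by (auto simp: restrict_fun_def fun_eq_iff)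
  then have *: "X V ?u = ?u * X V ?u + ?u * X V ?u"
    using vf_mult[OF that(1,2) _ u u] by simp
  have "X V ?u x = 0" for x
  proof (cases "x \<in> V")
    case True
    then show ?thesis using fun_cong[OF *, of x] by (simp add: restrict_fun_def)
  qed (simp add: vf_outside[OF that(1)])
  then have "X V ?u = 0" by (simp add: fun_eq_iff)
  have "restrict_fun V (\<lambda>_. c) = (\<lambda>x. c * ?u x)"
    by (auto simp: restrict_fun_def fun_eq_iff)
  then have "X V (restrict_fun V (\<lambda>_. c)) = X V (\<lambda>x. c * ?u x)"
    by simp
  also have "\<dots> = (\<lambda>x. c * X V ?u x)"
    using that u by (intro vf_const) auto
  also have "\<dots> = 0"
    using \<open>X V ?u = 0\<close> by (simp add: fun_eq_iff)
  finally show ?thesis .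
qed

lemma restrict_fun_simps [simp]:
  "restrict_fun W (f + g) = restrict_fun W f + restrict_fun W (g :: 'p \<Rightarrow> 'k)"
  "restrict_fun W (f - g) = restrict_fun W f - restrict_fun W g"
  "restrict_fun W (- f) = - restrict_fun W f"
  "restrict_fun W 0 = (0 :: 'p \<Rightarrow> 'k)"
  by (auto simp: restrict_fun_def fun_eq_iff)

lemma zero_VF: "0 \<in> VF V"
  by (rule VF_I) (auto simp: zero_mem fun_eq_iff)

lemma add_VF: "X + Y \<in> VF V" if "X \<in> VF V" "Y \<in> VF V"
proof (rule VF_I)
  fix W W' f assume "open W" "W \<subseteq> V" "f \<in> \<O> W" "open W'" "W' \<subseteq> W"
  then show "(X + Y) W' (restrict_fun W' f) = restrict_fun W' ((X + Y) W f)"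
    by (simp add: that[THEN vf_restrict])
qed (simp_all add: that[THEN vf_supp] that[THEN vf_mem] that[THEN vf_const] that[THEN vf_add]
      that[THEN vf_mult] add_mem fun_eq_iff algebra_simps)

lemma minus_VF: "- X \<in> VF V" if "X \<in> VF V"
proof (rule VF_I)
  fix W W' f assume "open W" "W \<subseteq> V" "f \<in> \<O> W" "open W'" "W' \<subseteq> W"
  then show "(- X) W' (restrict_fun W' f) = restrict_fun W' ((- X) W f)"
    by (simp add: that[THEN vf_restrict])
qed (simp_all add: that[THEN vf_supp] that[THEN vf_mem] that[THEN vf_const] that[THEN vf_add]
      that[THEN vf_mult] minus_mem fun_eq_iff algebra_simps)

lemma scale_VF: "scale_vf f X \<in> VF V" if "X \<in> VF V" "f \<in> \<O> V" "open V"
proof (rule VF_I)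
  show "scale_vf f X W g \<in> \<O> W" if W: "open W" "W \<subseteq> V" "g \<in> \<O> W" for W g
  proof -
    have "restrict_fun W f * X W g \<in> \<O> W"
      by (rule mult_mem[OF W(1) restrict_mem[OF \<open>open V\<close> \<open>f \<in> \<O> V\<close> W(1,2)] vf_mem[OF \<open>X \<in> VF V\<close> W]])
    moreover have "restrict_fun W f * X W g = scale_vf f X W g"
      using vf_outside[OF \<open>X \<in> VF V\<close>, of _ W g] by (auto simp: restrict_fun_def scale_vf_def fun_eq_iff)
    ultimately show ?thesis by simp
  qed
next
  fix W W' g assume "open W" "W \<subseteq> V" "g \<in> \<O> W" "open W'" "W' \<subseteq> W"
  then have "X W' (restrict_fun W' g) = restrict_fun W' (X W g)"
    by (rule vf_restrict[OF that(1)])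
  then show "scale_vf f X W' (restrict_fun W' g) = restrict_fun W' (scale_vf f X W g)"
    by (simp add: scale_vf_def) (simp add: restrict_fun_def fun_eq_iff)
qed (simp_all add: scale_vf_def that(1)[THEN vf_supp] that(1)[THEN vf_const] that(1)[THEN vf_add]
      that(1)[THEN vf_mult] fun_eq_iff algebra_simps)

lemma bracket_VF: "lie_bracket X Y \<in> VF V" if "X \<in> VF V" "Y \<in> VF V"
proof (rule VF_I)
  fix W f assume "\<not> (open W \<and> W \<subseteq> V \<and> f \<in> \<O> W)"
  then show "lie_bracket X Y W f = 0"
    by (simp add: lie_bracket_def that[THEN vf_supp] that[THEN vf_zero])
next
  fix W f g assume "open W" "W \<subseteq> V" "f \<in> \<O> W" "g \<in> \<O> W"
  then show "lie_bracket X Y W (f * g) = f * lie_bracket X Y W g + g * lie_bracket X Y W f"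
    by (simp add: lie_bracket_def that[THEN vf_mult] that[THEN vf_mem] that[THEN vf_add] mult_mem algebra_simps)
next
  fix W W' f assume "open W" "W \<subseteq> V" "f \<in> \<O> W" "open W'" "W' \<subseteq> W"
  then show "lie_bracket X Y W' (restrict_fun W' f) = restrict_fun W' (lie_bracket X Y W f)"
    by (simp add: lie_bracket_def that[THEN vf_mem] that[THEN vf_restrict])
qed (simp_all add: lie_bracket_def diff_mem that[THEN vf_mem] that[THEN vf_const] that[THEN vf_add] fun_eq_iff algebra_simps)

lemma restrict_VF: "restrict_vf W X \<in> VF W" if "X \<in> VF V" "W \<subseteq> V"
proof (rule VF_I)
  fix W' f assume "\<not> (open W' \<and> W' \<subseteq> W \<and> f \<in> \<O> W')"
  then show "restrict_vf W X W' f = 0"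
    using vf_supp[OF that(1), of W' f] that(2) by (auto simp: restrict_vf_def fun_eq_iff)
next
  fix W1 W2 f assume "open W1" "W1 \<subseteq> W" "f \<in> \<O> W1" "open W2" "W2 \<subseteq> W1"
  then show "restrict_vf W X W2 (restrict_fun W2 f) = restrict_fun W2 (restrict_vf W X W1 f)"
    using that(2) vf_restrict[OF that(1), of W1 f W2] by (auto simp: restrict_vf_def)
qed (use that(2) in \<open>auto simp: restrict_vf_def that(1)[THEN vf_mem] that(1)[THEN vf_const] that(1)[THEN vf_add]
      that(1)[THEN vf_mult]\<close>)

lemma restrict_vf_id: "X \<in> VF V \<Longrightarrow> restrict_vf V X = X"
  using vf_supp[of X V] by (auto simp: restrict_vf_def fun_eq_iff)

lemma restrict_vf_restrict: "W \<subseteq> V \<Longrightarrow> restrict_vf W (restrict_vf V X) = restrict_vf W X"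
  by (auto simp: restrict_vf_def fun_eq_iff)

lemma restrict_vf_simps [simp]:
  "restrict_vf W (X + Y) = restrict_vf W X + restrict_vf W (Y :: ('p, 'k) vfield)"
  "restrict_vf W (X - Y) = restrict_vf W X - restrict_vf W Y"
  "restrict_vf W 0 = (0 :: ('p, 'k) vfield)"
  by (auto simp: restrict_vf_def fun_eq_iff)

lemma restrict_vf_bracket:
  "restrict_vf W (lie_bracket X Y) = lie_bracket (restrict_vf W X) (restrict_vf W (Y :: ('p, 'k) vfield))"
  by (auto simp: restrict_vf_def fun_eq_iff lie_bracket_def)

lemma additive_subgroup_VF: "additive_subgroup (VF V)"
  by unfold_locales (auto simp: zero_VF add_VF minus_VF)

text \<open>
  A constant becomes a section of the structure sheaf over \<open>V\<close> after extension by zero; the two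
  multiplications agree since sections over \<open>V\<close> vanish outside \<open>V\<close>.
\<close>
lemma const_scale_eq: "const_scale_vf c X = scale_vf (restrict_fun V (\<lambda>_. c)) X" if "X \<in> VF V"
proof -
  have "X W f x = 0" if "x \<notin> V" for W f x
    using vf_outside[OF \<open>X \<in> VF V\<close>] vf_supp[OF \<open>X \<in> VF V\<close>] that by (metis subsetD zero_fun_apply)
  then show ?thesis
    by (auto simp: const_scale_vf_def scale_vf_def restrict_fun_def fun_eq_iff)
qed

text \<open>
  A derivation is determined by its values on functions, which are continuous, and a continuous function
  that vanishes on the dense subset \<open>W \<inter> U\<close> of \<open>W\<close> vanishes on \<open>W\<close>.
\<close>
lemma vf_eq_zero_if_dense:
  assumes "open V" "X \<in> VF V" "open U" "closure U = UNIV" "restrict_vf (V \<inter> U) X = 0"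
  shows "X = 0"
proof -
  have "X W f x = 0" if W: "open W" "W \<subseteq> V" "f \<in> \<O> W" and "x \<in> W" for W f x
  proof -
    have zero: "X W f y = 0" if "y \<in> W \<inter> U" for y
    proof -
      have "X (W \<inter> U) (restrict_fun (W \<inter> U) f) = restrict_fun (W \<inter> U) (X W f)"
        using W assms(3) by (intro vf_restrict[OF assms(2)]) auto
      moreover have "X (W \<inter> U) = restrict_vf (V \<inter> U) X (W \<inter> U)"
        using W(2) by (auto simp: restrict_vf_def fun_eq_iff)
      ultimately have "restrict_fun (W \<inter> U) (X W f) = 0"
        using assms(5) by simp
      then show ?thesis
        using that by (metis restrict_fun_def zero_fun_apply)
    qed
    have "continuous_on W (X W f)"
      using W vf_mem[OF assms(2)] cont by blast
    then have "closedin (top_of_set W) {y \<in> W. X W f y = 0}"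
      by (rule continuous_closedin_preimage_constant)
    then obtain T where T: "closed T" "{y \<in> W. X W f y = 0} = W \<inter> T"
      by (auto simp: closedin_closed)
    have "W \<inter> U \<subseteq> T" using zero T(2) by blast
    moreover have "W \<subseteq> closure (W \<inter> U)"
      using open_Int_closure_subset[OF W(1), of U] assms(4) by simp
    ultimately have "W \<subseteq> T"
      using T(1) closure_minimal by blast
    then show ?thesis using T(2) that(4) by blast
  qed
  then have "X W f x = 0" for W f x
    using vf_supp[OF assms(2), of W f] vf_outside[OF assms(2), of x W f]
    by (cases "open W \<and> W \<subseteq> V \<and> f \<in> \<O> W"; cases "x \<in> W") auto
  then show ?thesis
    by (simp add: fun_eq_iff)
qed

end

section \<open>Flat F-structures\<close>

text \<open>
  The data of a flat F-structure over \<open>A\<close> except for flatness, the compatibility of product and connection,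
  and the Hertling--Manin identity. The given structure over the whole manifold and the dual one over \<open>U\<close>
  are both instances.
\<close>
locale sheaf_torsionless_algebra = function_sheaf_space \<O>
  for \<O> :: "'p::topological_space set \<Rightarrow> ('p \<Rightarrow> 'k::real_normed_field) set" +
  fixes A :: "'p set" and m D :: "('p, 'k) op2" and e :: "('p, 'k) vfield"
  assumes m_sheaf: "sheaf_op2 \<O> A m"
    and e_VF: "e \<in> vector_fields \<O> A"
    and m_algebra: "\<And>V X Y Z. open V \<Longrightarrow> V \<subseteq> A \<Longrightarrow> X \<in> vector_fields \<O> V \<Longrightarrow> Y \<in> vector_fields \<O> V \<Longrightarrow>
        Z \<in> vector_fields \<O> V \<Longrightarrow>
        m V (X + Y) Z = m V X Z + m V Y Z \<and> m V X Y = m V Y X \<and>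
        m V (m V X Y) Z = m V X (m V Y Z) \<and> m V (restrict_vf V e) X = X"
    and m_scale: "\<And>V X Y f. open V \<Longrightarrow> V \<subseteq> A \<Longrightarrow> X \<in> vector_fields \<O> V \<Longrightarrow> Y \<in> vector_fields \<O> V \<Longrightarrow>
        f \<in> \<O> V \<Longrightarrow> m V (scale_vf f X) Y = scale_vf f (m V X Y)"
    and D_connection: "connection \<O> A D"
    and D_torsionless: "torsionless \<O> A D"
    and D_parallel: "parallel \<O> A D e"
begin

lemma sheaf_op2D:
  assumes "sheaf_op2 \<O> B q" "open V" "V \<subseteq> B" "X \<in> VF V" "Y \<in> VF V"
  shows "q V X Y \<in> VF V"
    and "open W \<Longrightarrow> W \<subseteq> V \<Longrightarrow> restrict_vf W (q V X Y) = q W (restrict_vf W X) (restrict_vf W Y)"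
  using assms unfolding sheaf_op2_def by auto

lemmas m_closed = sheaf_op2D(1)[OF m_sheaf] and m_restrict = sheaf_op2D(2)[OF m_sheaf]

lemma D_sheaf: "sheaf_op2 \<O> A D"
  using D_connection by (simp add: connection_def)

lemmas D_closed = sheaf_op2D(1)[OF D_sheaf] and D_restrict = sheaf_op2D(2)[OF D_sheaf]

lemma
  assumes "open V" "V \<subseteq> A" "X \<in> VF V" "Y \<in> VF V"
  shows D_add: "Z \<in> VF V \<Longrightarrow> D V (X + Y) Z = D V X Z + D V Y Z \<and> D V Z (X + Y) = D V Z X + D V Z Y"
    and D_scale_left: "f \<in> \<O> V \<Longrightarrow> D V (scale_vf f X) Y = scale_vf f (D V X Y)"
    and D_scale_right: "f \<in> \<O> V \<Longrightarrow> D V X (scale_vf f Y) = scale_vf (X V f) Y + scale_vf f (D V X Y)"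
    and D_torsion: "D V X Y - D V Y X = lie_bracket X Y"
  using assms D_connection D_torsionless unfolding connection_def torsionless_def by auto

lemma D_unit: "open V \<Longrightarrow> V \<subseteq> A \<Longrightarrow> X \<in> VF V \<Longrightarrow> D V X (restrict_vf V e) = 0"
  using D_parallel by (simp add: parallel_def)

lemma algebra:
  assumes V: "open V" "V \<subseteq> A"
  shows "torsionless_algebra (VF V) (m V) (D V) lie_bracket (restrict_vf V e)"
proof -
  interpret additive_subgroup "VF V" by (rule additive_subgroup_VF)
  show ?thesis
  proof
    show "biadditive_on (VF V) (m V)"
      unfolding biadditive_on_def
    proof (intro ballI conjI)
      fix X Y Z assume *: "X \<in> VF V" "Y \<in> VF V" "Z \<in> VF V"
      show "m V (X + Y) Z = m V X Z + m V Y Z"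
        using m_algebra[OF V *] by blast
      then show "m V Z (X + Y) = m V Z X + m V Z Y"
        using m_algebra[OF V *(1,3,2)] m_algebra[OF V *(2,3,1)] m_algebra[OF V add_VF[OF *(1,2)] *(3,3)] by simp
    qed (rule m_closed[OF V])
    show "biadditive_on (VF V) (D V)"
      using D_add[OF V] D_closed[OF V] by (simp add: biadditive_on_def)
    show "lie_bracket X Y = D V X Y - D V Y X" if "X \<in> VF V" "Y \<in> VF V" for X Y
      using D_torsion[OF V that] by simp
    show "restrict_vf V e \<in> VF V"
      using e_VF V by (intro restrict_VF)
  qed (use m_algebra[OF V] in blast)+
qed

abbreviation "curvature_on V \<equiv> torsionless_algebra.curvature (D V) lie_bracket"
abbreviation "codazzi_on V \<equiv> torsionless_algebra.codazzi (m V) (D V) lie_bracket"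

lemma shifted_curvature:
  fixes c :: 'k
  assumes V: "open V" "V \<subseteq> A" and X: "X \<in> VF V" "Y \<in> VF V" "Z \<in> VF V"
  defines "D' \<equiv> \<lambda>X Y. D V X Y - const_scale_vf c (m V X Y)"
  shows "D' X (D' Y Z) - D' Y (D' X Z) - D' (lie_bracket X Y) Z =
    curvature_on V X Y Z - const_scale_vf c (codazzi_on V X Y Z)"
proof -
  interpret torsionless_algebra "VF V" "m V" "D V" lie_bracket "restrict_vf V e"
    by (rule algebra[OF V])
  let ?c = "restrict_fun V (\<lambda>_. c)"
  have c: "?c \<in> \<O> V" by (rule const_mem[OF V(1)])
  have sc: "const_scale_vf c Z = scale_vf ?c Z" if "Z \<in> VF V" for Z
    by (rule const_scale_eq[OF that])
  show ?thesis
    unfolding D'_def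
  proof (rule curvature_shift)
    fix X Y assume *: "X \<in> VF V" "Y \<in> VF V"
    show "const_scale_vf c X \<in> VF V"
      unfolding sc[OF *(1)] by (rule scale_VF[OF *(1) c V(1)])
    show "m V (const_scale_vf c X) Y = const_scale_vf c (m V X Y)"
      unfolding sc[OF *(1)] sc[OF m_closed[OF V *]] by (rule m_scale[OF V * c])
    show "D V (const_scale_vf c X) Y = const_scale_vf c (D V X Y)"
      unfolding sc[OF *(1)] sc[OF D_closed[OF V *]] by (rule D_scale_left[OF V * c])
    have "scale_vf (X V ?c) Y = 0"
      by (simp add: vf_constant[OF *(1) V(1)] scale_vf_def fun_eq_iff)
    then show "D V X (const_scale_vf c Y) = const_scale_vf c (D V X Y)"
      unfolding sc[OF *(2)] sc[OF D_closed[OF V *]] D_scale_right[OF V * c] by simp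
    show "const_scale_vf c (X + Y) = const_scale_vf c X + const_scale_vf c Y"
      by (simp add: const_scale_vf_def scale_vf_def fun_eq_iff algebra_simps)
  qed (use X in auto)
qed

lemma F_manifold_if_codazzi:
  assumes codazzi: "\<And>V X Y Z. open V \<Longrightarrow> V \<subseteq> A \<Longrightarrow> X \<in> VF V \<Longrightarrow> Y \<in> VF V \<Longrightarrow> Z \<in> VF V \<Longrightarrow> codazzi_on V X Y Z = 0"
  shows "F_manifold \<O> A m e"
  unfolding F_manifold_def
proof (intro conjI allI impI ballI)
  fix V X Y Z assume "open V \<and> V \<subseteq> A" and X: "X \<in> VF V" "Y \<in> VF V" "Z \<in> VF V"
  then have V: "open V" "V \<subseteq> A" by auto
  interpret torsionless_algebra "VF V" "m V" "D V" lie_bracket "restrict_vf V e"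
    by (rule algebra[OF V])
  show "m V (X + Y) Z = m V X Z + m V Y Z" "m V Z (X + Y) = m V Z X + m V Z Y"
    using X by simp_all
  show "m V X Y = m V Y X" "m V (m V X Y) Z = m V X (m V Y Z)" "m V (restrict_vf V e) X = X"
    using X by (auto intro: p_comm p_assoc)
  show scale: "m V (scale_vf f X) Y = scale_vf f (m V X Y)" if "f \<in> \<O> V" for f
    by (rule m_scale[OF V X(1,2) that])
  show "m V X (scale_vf f Y) = scale_vf f (m V X Y)" if "f \<in> \<O> V" for f
    using m_scale[OF V X(2,1) that] p_comm[OF X(1) scale_VF[OF X(2) that V(1)]] p_comm[OF X(1,2)] by simp
  fix W assume W: "W \<in> VF V"
  have "hertling_manin X Y Z W = 0"
    using codazzi[OF V] X W by (intro hertling_manin_if_codazzi)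
  then show "lie_bracket (m V X Y) (m V W Z)
      - m V (lie_bracket (m V X Y) Z) W - m V (lie_bracket (m V X Y) W) Z
      - m V X (lie_bracket Y (m V Z W))
      + m V X (m V (lie_bracket Y Z) W) + m V X (m V (lie_bracket Y W) Z)
      - m V Y (lie_bracket X (m V Z W))
      + m V Y (m V (lie_bracket X Z) W) + m V Y (m V (lie_bracket X W) Z) = 0"
    by (simp only: hertling_manin_def)
qed (rule m_sheaf e_VF)+

text \<open>
  The curvatures for \<open>\<lambda> = 0\<close> and \<open>\<lambda> = 1\<close> determine \<open>R\<close> and \<open>T\<close>; the Hertling--Manin identity comes from
  \<open>F_manifold_if_codazzi\<close>.
\<close>
lemma flat_F_structure_iff:
  "flat_F_structure \<O> A D m e \<longleftrightarrow>
     (\<forall>V. open V \<and> V \<subseteq> A \<longrightarrow> (\<forall>X\<in>VF V. \<forall>Y\<in>VF V. \<forall>Z\<in>VF V.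
        curvature_on V X Y Z = 0 \<and> codazzi_on V X Y Z = 0))" (is "_ \<longleftrightarrow> ?R")
proof
  assume "flat_F_structure \<O> A D m e"
  then have flat: "flat \<O> A (\<lambda>V X Y. D V X Y - const_scale_vf c (m V X Y))" for c
    by (simp add: flat_F_structure_def)
  show ?R
  proof (intro allI impI ballI)
    fix V X Y Z assume "open V \<and> V \<subseteq> A" and X: "X \<in> VF V" "Y \<in> VF V" "Z \<in> VF V"
    then have V: "open V" "V \<subseteq> A" by auto
    have *: "curvature_on V X Y Z - const_scale_vf c (codazzi_on V X Y Z) = 0" for c
      using flat[of c] V X shifted_curvature[OF V X, of c] unfolding flat_def by simp
    have "const_scale_vf 0 Q = 0" "const_scale_vf 1 Q = Q" for Q :: "('p, 'k) vfield"
      by (simp_all add: const_scale_vf_def scale_vf_def fun_eq_iff)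
    then show "curvature_on V X Y Z = 0 \<and> codazzi_on V X Y Z = 0"
      using *[of 0] *[of 1] by simp
  qed
next
  assume R: ?R
  have "flat \<O> A (\<lambda>V X Y. D V X Y - const_scale_vf c (m V X Y))" for c
    unfolding flat_def
  proof (intro allI impI ballI)
    fix V X Y Z assume "open V \<and> V \<subseteq> A" and X: "X \<in> VF V" "Y \<in> VF V" "Z \<in> VF V"
    then have V: "open V" "V \<subseteq> A" by auto
    have "const_scale_vf c 0 = 0"
      by (simp add: const_scale_vf_def scale_vf_def fun_eq_iff)
    then show "D V X (D V Y Z - const_scale_vf c (m V Y Z)) - const_scale_vf c (m V X (D V Y Z - const_scale_vf c (m V Y Z)))
      - (D V Y (D V X Z - const_scale_vf c (m V X Z)) - const_scale_vf c (m V Y (D V X Z - const_scale_vf c (m V X Z))))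
      - (D V (lie_bracket X Y) Z - const_scale_vf c (m V (lie_bracket X Y) Z)) = 0"
      using R V X shifted_curvature[OF V X, of c] by simp
  qed
  moreover have "torsionless \<O> A (\<lambda>V X Y. D V X Y - const_scale_vf c (m V X Y))" for c
    unfolding torsionless_def
  proof (intro allI impI ballI)
    fix V X Y assume "open V \<and> V \<subseteq> A" and X: "X \<in> VF V" "Y \<in> VF V"
    then have V: "open V" "V \<subseteq> A" by auto
    have "m V X Y = m V Y X"
      using m_algebra[OF V X X(1)] by blast
    then show "D V X Y - const_scale_vf c (m V X Y) - (D V Y X - const_scale_vf c (m V Y X)) = lie_bracket X Y"
      using D_torsion[OF V X] by simp
  qed
  moreover have "F_manifold \<O> A m e"
    using R by (intro F_manifold_if_codazzi) blast
  ultimately show "flat_F_structure \<O> A D m e"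
    using D_connection D_parallel by (simp add: flat_F_structure_def)
qed

end

section \<open>F-manifolds with an Euler vector field\<close>

locale euler_manifold = function_sheaf_space \<O>
  for \<O> :: "'p::topological_space set \<Rightarrow> ('p \<Rightarrow> 'k::real_normed_field) set" +
  fixes m D :: "('p, 'k) op2" and e E :: "('p, 'k) vfield" and U :: "'p set"
  assumes F_man: "F_manifold \<O> UNIV m e"
    and euler: "euler_field \<O> UNIV m e E"
    and conn: "connection \<O> UNIV D"
    and tors: "torsionless \<O> UNIV D"
    and par: "parallel \<O> UNIV D e"
    and nabla_E: "invertible_op1 \<O> UNIV (nabla_op D E)"
    and U_open: "open U" and U_dense: "closure U = UNIV"
    and mult_E: "invertible_op1 \<O> U (mult_op m E)"
begin

sublocale base: sheaf_torsionless_algebra \<O> UNIV m D e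
proof
  fix V X Y Z
  assume V: "open V" "V \<subseteq> (UNIV :: 'p set)" and X: "X \<in> VF V" "Y \<in> VF V"
  note F = F_man[unfolded F_manifold_def, THEN conjunct2, THEN conjunct2, THEN spec, THEN mp, OF conjI[OF V],
      THEN bspec, THEN bspec, THEN bspec, OF X]
  show "m V (X + Y) Z = m V X Z + m V Y Z \<and> m V X Y = m V Y X \<and>
      m V (m V X Y) Z = m V X (m V Y Z) \<and> m V (restrict_vf V e) X = X" if "Z \<in> VF V"
    using F[OF that] by blast
  show "m V (scale_vf f X) Y = scale_vf f (m V X Y)" if "f \<in> \<O> V" for f
    using F[OF X(1)] that by simp
qed (use F_man conn tors par in \<open>auto simp: F_manifold_def\<close>)

lemma E_VF: "E \<in> VF UNIV"
  using euler by (simp add: euler_field_def)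

lemma euler_algebra:
  assumes V: "open V"
  shows "euler_algebra (VF V) (m V) (D V) lie_bracket (restrict_vf V e) (restrict_vf V E)"
proof -
  interpret torsionless_algebra "VF V" "m V" "D V" lie_bracket "restrict_vf V e"
    using V by (intro base.algebra) auto
  show ?thesis
  proof
    fix X Y Z W assume X: "X \<in> VF V" "Y \<in> VF V"
    show "lie_bracket (restrict_vf V E) (m V X Y) - m V (lie_bracket (restrict_vf V E) X) Y -
        m V X (lie_bracket (restrict_vf V E) Y) = m V X Y"
      using euler V X by (simp add: euler_field_def)
    assume Z: "Z \<in> VF V" "W \<in> VF V"
    show "hertling_manin X Y Z W = 0"
      unfolding hertling_manin_def
      using F_man[unfolded F_manifold_def, THEN conjunct2, THEN conjunct2, THEN spec, THEN mp, OF conjI[OF V],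
        THEN bspec, THEN bspec, THEN bspec, OF _ X Z(1)] Z(2) by blast
  next
    show "restrict_vf V E \<in> VF V"
      by (rule restrict_VF[OF E_VF]) simp

    show "D V X (restrict_vf V e) = 0" if "X \<in> VF V" for X
      using base.D_unit[OF V _ that] by simp
  qed
qed

definition inverse_E :: "'p set \<Rightarrow> ('p, 'k) vfield" where
  "inverse_E V = the_inv_into (VF V) (mult_op m E V) (restrict_vf V e)"

lemma mult_E_bij: "open V \<Longrightarrow> V \<subseteq> U \<Longrightarrow> bij_betw (mult_op m E V) (VF V) (VF V)"
  using mult_E by (simp add: invertible_op1_def)

lemma almost_dual:
  assumes V: "open V" "V \<subseteq> U"
  shows "almost_dual (VF V) (m V) (D V) lie_bracket (restrict_vf V e) (restrict_vf V E) (inverse_E V)"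
proof -
  interpret euler_algebra "VF V" "m V" "D V" lie_bracket "restrict_vf V e" "restrict_vf V E"
    by (rule euler_algebra[OF V(1)])
  note bij = mult_E_bij[OF V]
  show ?thesis
  proof
    show "inverse_E V \<in> VF V"
      using bij_betw_apply[OF bij_betw_the_inv_into[OF bij] e_closed] by (simp add: inverse_E_def)
    show "m V (restrict_vf V E) (inverse_E V) = restrict_vf V e"
      using f_the_inv_into_f_bij_betw[OF bij, of "restrict_vf V e"] by (simp add: inverse_E_def mult_op_def)
  qed
qed

lemma nabla_E_inj:
  assumes "open V" "X \<in> VF V" "D V X (restrict_vf V E) = 0"
  shows "X = 0"
proof -
  interpret euler_algebra "VF V" "m V" "D V" lie_bracket "restrict_vf V e" "restrict_vf V E"
    by (rule euler_algebra[OF assms(1)])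
  have "inj_on (nabla_op D E V) (VF V)"
    using nabla_E assms(1) by (auto simp: invertible_op1_def bij_betw_def)
  moreover have "nabla_op D E V X = nabla_op D E V 0"
    using assms(3) by (simp add: nabla_op_def)
  ultimately show ?thesis
    using assms(2) by (auto dest: inj_onD)
qed

abbreviation "m_dual \<equiv> dual_product \<O> m E"
abbreviation "D_dual \<equiv> dual_connection \<O> D m E"

lemma
  assumes V: "open V" "V \<subseteq> U" and X: "X \<in> VF V" "Y \<in> VF V"
  shows dual_m_eq: "m_dual V X Y = almost_dual.star (m V) (inverse_E V) X Y"
    and dual_D_eq: "D_dual V X Y = almost_dual.dual_D (m V) (D V) (restrict_vf V E) (inverse_E V) X Y"
    and dual_m_closed: "m_dual V X Y \<in> VF V"
    and dual_D_closed: "D_dual V X Y \<in> VF V"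
proof -
  interpret almost_dual "VF V" "m V" "D V" lie_bracket "restrict_vf V e" "restrict_vf V E" "inverse_E V"
    by (rule almost_dual[OF V])
  show *: "m_dual V X Y = star X Y"
    unfolding dual_product_def using mult_E_bij[OF V] X
    by (intro the_inv_into_f_eq) (auto simp: bij_betw_def mult_op_def star_def)
  then show **: "D_dual V X Y = dual_D X Y"
    by (simp add: dual_connection_def dual_D_def nabla_op_def)
  show "m_dual V X Y \<in> VF V" "D_dual V X Y \<in> VF V"
    unfolding * ** using X by (simp_all add: dual_D_def)
qed

text \<open>
  This characterisation determines the behaviour of the dual product under restriction to smaller open
  sets and under multiplication by functions.
\<close>
lemma dual_m_unique:
  assumes V: "open V" "V \<subseteq> U" and S: "S \<in> VF V" "m V (restrict_vf V E) S = m V X Y"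
  shows "m_dual V X Y = S"
  unfolding dual_product_def using mult_E_bij[OF V] S
  by (intro the_inv_into_f_eq) (auto simp: bij_betw_def mult_op_def)

lemma mult_E_dual_m:
  assumes V: "open V" "V \<subseteq> U" and X: "X \<in> VF V" "Y \<in> VF V"
  shows "m V (restrict_vf V E) (m_dual V X Y) = m V X Y"
proof -
  interpret almost_dual "VF V" "m V" "D V" lie_bracket "restrict_vf V e" "restrict_vf V E" "inverse_E V"
    by (rule almost_dual[OF V])
  show ?thesis using X by (simp add: dual_m_eq[OF V X] star_def)
qed

lemma dual_D_unfold: "D_dual V X Y = D V X Y - D V (m_dual V X Y) (restrict_vf V E)"
  by (simp add: dual_connection_def nabla_op_def)

lemma dual_m_restrict:
  assumes V: "open V" "V \<subseteq> U" and X: "X \<in> VF V" "Y \<in> VF V" and W: "open W" "W \<subseteq> V"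
  shows "m_dual W (restrict_vf W X) (restrict_vf W Y) = restrict_vf W (m_dual V X Y)"
proof (rule dual_m_unique)
  have E: "restrict_vf V E \<in> VF V" by (rule restrict_VF[OF E_VF]) simp
  note closed = dual_m_closed[OF V X]
  have "m W (restrict_vf W E) (restrict_vf W (m_dual V X Y)) =
      restrict_vf W (m V (restrict_vf V E) (m_dual V X Y))"
    using base.m_restrict[OF V(1) _ E closed W] by (simp add: restrict_vf_restrict[OF W(2)])
  also have "\<dots> = m W (restrict_vf W X) (restrict_vf W Y)"
    unfolding mult_E_dual_m[OF V X] using base.m_restrict[OF V(1) _ X W] by simp
  finally show "m W (restrict_vf W E) (restrict_vf W (m_dual V X Y)) = m W (restrict_vf W X) (restrict_vf W Y)" .
qed (use V W restrict_VF[OF dual_m_closed[OF V X]] in auto)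

lemma dual_m_sheaf: "sheaf_op2 \<O> U m_dual"
  unfolding sheaf_op2_def using dual_m_closed dual_m_restrict by blast

lemma dual_D_sheaf: "sheaf_op2 \<O> U D_dual"
  unfolding sheaf_op2_def
proof (intro allI impI ballI conjI)
  fix V X Y W assume "open V \<and> V \<subseteq> U" and X: "X \<in> VF V" "Y \<in> VF V"
  then have V: "open V" "V \<subseteq> U" by auto
  show "D_dual V X Y \<in> VF V" by (rule dual_D_closed[OF V X])
  assume "open W \<and> W \<subseteq> V"
  then have W: "open W" "W \<subseteq> V" by auto
  have E: "restrict_vf V E \<in> VF V" by (rule restrict_VF[OF E_VF]) simp
  show "D_dual W (restrict_vf W X) (restrict_vf W Y) = restrict_vf W (D_dual V X Y)"
    unfolding dual_D_unfold dual_m_restrict[OF V X W]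
    using base.D_restrict[OF V(1) _ X W] base.D_restrict[OF V(1) _ dual_m_closed[OF V X] E W]
    by (simp add: restrict_vf_restrict[OF W(2)])
qed

lemma dual_m_scale:
  assumes V: "open V" "V \<subseteq> U" and X: "X \<in> VF V" "Y \<in> VF V" and f: "f \<in> \<O> V"
  shows "m_dual V (scale_vf f X) Y = scale_vf f (m_dual V X Y)"
    and "m_dual V X (scale_vf f Y) = scale_vf f (m_dual V X Y)"
proof -
  interpret almost_dual "VF V" "m V" "D V" lie_bracket "restrict_vf V e" "restrict_vf V E" "inverse_E V"
    by (rule almost_dual[OF V])
  note closed = dual_m_closed[OF V X]
  note fX = scale_VF[OF X(1) f V(1)] and fY = scale_VF[OF X(2) f V(1)] and fS = scale_VF[OF closed f V(1)]
  have "m V (restrict_vf V E) (scale_vf f (m_dual V X Y)) = scale_vf f (m V X Y)"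
    using base.m_scale[OF V(1) _ closed E_closed f] mult_E_dual_m[OF V X]
    by (simp add: p_comm[OF E_closed fS] p_comm[OF E_closed closed])
  moreover have "m V (scale_vf f X) Y = scale_vf f (m V X Y)"
    using base.m_scale[OF V(1) _ X f] by simp
  moreover have "m V X (scale_vf f Y) = scale_vf f (m V X Y)"
    using base.m_scale[OF V(1) _ X(2,1) f] by (simp add: p_comm[OF X(1) fY] p_comm[OF X])
  ultimately show "m_dual V (scale_vf f X) Y = scale_vf f (m_dual V X Y)"
      "m_dual V X (scale_vf f Y) = scale_vf f (m_dual V X Y)"
    using fS by (auto intro!: dual_m_unique[OF V])
qed

lemma scale_vf_diff: "scale_vf f (X - Y) = scale_vf f X - scale_vf f (Y :: ('p, 'k) vfield)"
  by (simp add: scale_vf_def fun_eq_iff algebra_simps)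

sublocale dual_sheaf: sheaf_torsionless_algebra \<O> U m_dual D_dual "restrict_vf U E"
proof
  show "sheaf_op2 \<O> U m_dual" by (rule dual_m_sheaf)
  show "restrict_vf U E \<in> VF U" by (rule restrict_VF[OF E_VF]) simp
  show "connection \<O> U D_dual"
    unfolding connection_def
  proof (intro conjI allI impI ballI)
    show "sheaf_op2 \<O> U D_dual" by (rule dual_D_sheaf)
    fix V X Y assume "open V \<and> V \<subseteq> U" and X: "X \<in> VF V" "Y \<in> VF V"
    then have V: "open V" "V \<subseteq> U" by auto
    interpret almost_dual "VF V" "m V" "D V" lie_bracket "restrict_vf V e" "restrict_vf V E" "inverse_E V"
      by (rule almost_dual[OF V])
    note closed = dual_m_closed[OF V X]
    { fix Z assume Z: "Z \<in> VF V"
      show "D_dual V (X + Y) Z = D_dual V X Z + D_dual V Y Z" "D_dual V Z (X + Y) = D_dual V Z X + D_dual V Z Y"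
        using X Z biadditive_onD(2,3)[OF dual_D_biadditive] by (simp_all add: dual_D_eq[OF V]) }
    fix f assume f: "f \<in> \<O> V"
    show "D_dual V (scale_vf f X) Y = scale_vf f (D_dual V X Y)"
      using base.D_scale_left[OF V(1) _ X f] base.D_scale_left[OF V(1) _ closed E_closed f]
      by (simp add: dual_D_unfold dual_m_scale[OF V X f] scale_vf_diff)
    show "D_dual V X (scale_vf f Y) = scale_vf (X V f) Y + scale_vf f (D_dual V X Y)"
      using base.D_scale_right[OF V(1) _ X f] base.D_scale_left[OF V(1) _ closed E_closed f]
      by (simp add: dual_D_unfold dual_m_scale[OF V X f] scale_vf_diff)
  qed
  show "torsionless \<O> U D_dual"
    unfolding torsionless_def
  proof (intro allI impI ballI)
    fix V X Y assume "open V \<and> V \<subseteq> U" and X: "X \<in> VF V" "Y \<in> VF V"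
    then have V: "open V" "V \<subseteq> U" by auto
    interpret almost_dual "VF V" "m V" "D V" lie_bracket "restrict_vf V e" "restrict_vf V E" "inverse_E V"
      by (rule almost_dual[OF V])
    show "D_dual V X Y - D_dual V Y X = lie_bracket X Y"
      using X dual.br_eq[OF X] by (simp add: dual_D_eq[OF V])
  qed
  show "parallel \<O> U D_dual (restrict_vf U E)"
    unfolding parallel_def
  proof (intro allI impI ballI)
    fix V X assume "open V \<and> V \<subseteq> U" and X: "X \<in> VF V"
    then have V: "open V" "V \<subseteq> U" by auto
    interpret almost_dual "VF V" "m V" "D V" lie_bracket "restrict_vf V e" "restrict_vf V E" "inverse_E V"
      by (rule almost_dual[OF V])
    have "m_dual V X (restrict_vf V E) = X"
      using X p_comm[OF X E_closed] by (intro dual_m_unique[OF V]) auto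
    then show "D_dual V X (restrict_vf V (restrict_vf U E)) = 0"
      by (simp add: restrict_vf_restrict[OF V(2)] dual_D_unfold)
  qed
next
  fix V X Y Z assume V: "open V" "V \<subseteq> U" and X: "X \<in> VF V" "Y \<in> VF V"
  interpret almost_dual "VF V" "m V" "D V" lie_bracket "restrict_vf V e" "restrict_vf V E" "inverse_E V"
    by (rule almost_dual[OF V])
  show "m_dual V (scale_vf f X) Y = scale_vf f (m_dual V X Y)" if "f \<in> \<O> V" for f
    by (rule dual_m_scale[OF V X that])
  assume Z: "Z \<in> VF V"
  show "m_dual V (X + Y) Z = m_dual V X Z + m_dual V Y Z \<and>
      m_dual V X Y = m_dual V Y X \<and>
      m_dual V (m_dual V X Y) Z = m_dual V X (m_dual V Y Z) \<and>
      m_dual V (restrict_vf V (restrict_vf U E)) X = X"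
    unfolding restrict_vf_restrict[OF V(2)]
    using X Z dual.p_comm[OF X] dual.p_assoc[OF X Z] by (simp add: dual_m_eq[OF V])
qed

end

section \<open>Vector-valued forms\<close>

lemma const_scale_sign: "const_scale_vf ((-1) ^ i) X = signed i (X :: ('p, 'k::real_normed_field) vfield)"
  by (auto simp: const_scale_vf_def scale_vf_def signed_def fun_eq_iff)

lemma d_op_eq_koszul:
  "d_op L D \<omega> V = koszul (\<lambda>X. D V (L V X)) (twisted_bracket L V) (\<omega> V)"
  by (rule ext) (simp add: d_op_def koszul_def const_scale_sign)

context function_sheaf_space
begin

text \<open>Skew-symmetry follows from the vanishing on repeated arguments, by expanding \<open>\<omega>(\<dots>, a + b, a + b, \<dots>) = 0\<close>.\<close>
lemma tforms_skew:
  assumes \<omega>: "\<omega> \<in> tforms \<O> V k" and W: "open W" "W \<subseteq> V"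
  shows "(\<lambda>xs. if length xs = k then \<omega> W xs else 0) \<in> skew_forms (VF W)"
proof -
  have closed: "\<omega> W xs \<in> VF W" if "set xs \<subseteq> VF W" "length xs = k" for xs
    using \<omega> W that by (simp add: tforms_def)
  have add: "\<omega> W (us @ (a + b) # vs) = \<omega> W (us @ a # vs) + \<omega> W (us @ b # vs)"
    if "set us \<subseteq> VF W" "set vs \<subseteq> VF W" "a \<in> VF W" "b \<in> VF W" "Suc (length us + length vs) = k" for us vs a b
  proof -
    have "\<forall>i<k. \<forall>Y\<in>VF W. \<forall>Z\<in>VF W. \<omega> W ((us @ a # vs)[i := Y + Z]) =
        \<omega> W ((us @ a # vs)[i := Y]) + \<omega> W ((us @ a # vs)[i := Z])"
      using \<omega> W that by (simp add: tforms_def)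
    then show ?thesis
      using that by (auto dest!: spec[of _ "length us"])
  qed
  have alt: "\<omega> W (us @ a # a # vs) = 0"
    if "set us \<subseteq> VF W" "set vs \<subseteq> VF W" "a \<in> VF W" "Suc (Suc (length us + length vs)) = k" for us vs a
  proof -
    have "\<forall>i j. i < j \<and> j < k \<and> (us @ a # a # vs) ! i = (us @ a # a # vs) ! j \<longrightarrow> \<omega> W (us @ a # a # vs) = 0"
      using \<omega> W that by (simp add: tforms_def)
    from this[THEN spec[of _ "length us"], THEN spec[of _ "Suc (length us)"]] show ?thesis
      using that(4) by (simp add: nth_append)
  qed
  show ?thesis
  proof (rule skew_formsI)
    fix us vs a b assume *: "set us \<subseteq> VF W" "set vs \<subseteq> VF W" "a \<in> VF W" "b \<in> VF W"
    show "(if length (us @ (a + b) # vs) = k then \<omega> W (us @ (a + b) # vs) else 0) =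
        (if length (us @ a # vs) = k then \<omega> W (us @ a # vs) else 0) +
        (if length (us @ b # vs) = k then \<omega> W (us @ b # vs) else 0)"
      using add[OF *] by simp
    show "(if length (us @ a # b # vs) = k then \<omega> W (us @ a # b # vs) else 0) =
        - (if length (us @ b # a # vs) = k then \<omega> W (us @ b # a # vs) else 0)"
    proof (cases "Suc (Suc (length us + length vs)) = k")
      case True
      have ab: "a + b \<in> VF W" using * by (intro add_VF)
      have split: "\<omega> W (us @ x # (a + b) # vs) = \<omega> W (us @ x # a # vs) + \<omega> W (us @ x # b # vs)"
        if "x \<in> VF W" for x
        using add[of "us @ [x]" vs a b] * that True by simp
      have "0 = \<omega> W (us @ (a + b) # (a + b) # vs)"
        using alt[OF *(1,2) ab True] by simp
      also have "\<dots> = \<omega> W (us @ a # (a + b) # vs) + \<omega> W (us @ b # (a + b) # vs)"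
        using add[of us "(a + b) # vs" a b] * ab True by simp
      also have "\<dots> = \<omega> W (us @ a # b # vs) + \<omega> W (us @ b # a # vs)"
        using split[of a] split[of b] * alt[OF *(1,2) _ True] by simp
      finally show ?thesis
        using True by (simp add: eq_neg_iff_add_eq_0)
    qed simp
  qed (use closed zero_VF in auto)
qed

text \<open>A vector field as a form of degree zero, the test form that extracts curvatures from the bicomplex.\<close>
lemma constant_tform: "(\<lambda>W xs. restrict_vf W Z) \<in> tforms \<O> V 0" if "Z \<in> VF V"
  using that by (auto simp: tforms_def restrict_VF restrict_vf_restrict)

end

section \<open>The bicomplex and the bi-flat structure\<close>

context euler_manifold
begin

abbreviation "D_L V \<equiv> \<lambda>X Z. D_dual V (m V (restrict_vf V E) X) Z"

definition mixed_curvature where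
  "mixed_curvature V X Y Z =
     D V X (D_L V Y Z) - D V Y (D_L V X Z) - D_L V (lie_bracket X Y) Z
     + (D_L V X (D V Y Z) - D_L V Y (D V X Z) - D V (twisted_bracket (mult_op m E) V X Y) Z)"

lemma twisted_bracket_id: "twisted_bracket id_op V = (lie_bracket :: ('p, 'k) vfield \<Rightarrow> _)"
  by (simp add: twisted_bracket_def id_op_def fun_eq_iff)

lemma d_op_eqs:
  "d_op id_op D \<omega> V = koszul (D V) lie_bracket (\<omega> V)"
  "d_op (mult_op m E) D_dual \<omega> V = koszul (D_L V) (twisted_bracket (mult_op m E) V) (\<omega> V)"
  unfolding d_op_eq_koszul twisted_bracket_id by (simp_all add: id_op_def mult_op_def)

text \<open>The bicomplex equations in degree zero, with the factor \<open>L\<close> removed from the arguments of the second one.\<close>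
definition bicomplex_curvatures_vanish where
  "bicomplex_curvatures_vanish \<longleftrightarrow> (\<forall>V. open V \<and> V \<subseteq> U \<longrightarrow> (\<forall>X\<in>VF V. \<forall>Y\<in>VF V. \<forall>Z\<in>VF V.
     base.curvature_on V X Y Z = 0 \<and> dual_sheaf.curvature_on V X Y Z = 0 \<and> mixed_curvature V X Y Z = 0))"

text \<open>
  The operations of the dual structure agree with those of the locale \<open>almost_dual\<close> on vector fields only,
  so the identities between expressions built from them are transferred one by one.
\<close>
lemma local_dual_eqs:
  assumes V: "open V" "V \<subseteq> U" and X: "X \<in> VF V" "Y \<in> VF V" "Z \<in> VF V"
  shows "dual_sheaf.curvature_on V X Y Z =
      torsionless_algebra.curvature (almost_dual.dual_D (m V) (D V) (restrict_vf V E) (inverse_E V)) lie_bracket X Y Z"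
    and "dual_sheaf.codazzi_on V X Y Z =
      torsionless_algebra.codazzi (almost_dual.star (m V) (inverse_E V))
        (almost_dual.dual_D (m V) (D V) (restrict_vf V E) (inverse_E V)) lie_bracket X Y Z"
    and "twisted_bracket (mult_op m E) V X Y = euler_algebra.twisted (m V) lie_bracket (restrict_vf V E) X Y"
    and "mixed_curvature V X Y Z = almost_dual.mixed (m V) (D V) lie_bracket (restrict_vf V E) (inverse_E V) X Y Z"
proof -
  interpret A: almost_dual "VF V" "m V" "D V" lie_bracket "restrict_vf V e" "restrict_vf V E" "inverse_E V"
    by (rule almost_dual[OF V])
  interpret S: torsionless_algebra "VF V" "m_dual V" "D_dual V" lie_bracket "restrict_vf V (restrict_vf U E)"
    by (rule dual_sheaf.algebra[OF V])
  note [simp] = dual_D_eq[OF V] dual_m_eq[OF V] X dual_m_closed[OF V] dual_D_closed[OF V] bracket_VF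
  have [simp]: "A.dual_D P Q \<in> VF V" if "P \<in> VF V" "Q \<in> VF V" for P Q
    using that by (rule A.dual.D_simps(1))
  show "S.curvature X Y Z = A.dual.curvature X Y Z"
    by (simp add: S.curvature_def A.dual.curvature_def)
  show "S.codazzi X Y Z = A.dual.codazzi X Y Z"
    by (simp add: S.codazzi_def A.dual.codazzi_def)
  show *: "twisted_bracket (mult_op m E) V X Y = A.twisted X Y"
    by (simp add: twisted_bracket_def A.twisted_def mult_op_def)
  show "mixed_curvature V X Y Z = A.mixed X Y Z"
    by (simp add: mixed_curvature_def A.mixed_def * algebra_simps)
qed

text \<open>
  The equations in degree zero give the curvatures; conversely the vanishing curvatures make the two
  structures and their sum representations of Lie brackets, and then the equations hold in every degree.
\<close>
lemma bicomplex_iff_curvatures: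
  "differential_bicomplex \<O> U (d_op id_op D) (d_op (mult_op m E) D_dual) \<longleftrightarrow> bicomplex_curvatures_vanish"
proof
  assume bi: "differential_bicomplex \<O> U (d_op id_op D) (d_op (mult_op m E) D_dual)"
  show bicomplex_curvatures_vanish
    unfolding bicomplex_curvatures_vanish_def
  proof (intro allI impI)
    fix V assume "open V \<and> V \<subseteq> U"
    then have V: "open V" "V \<subseteq> U" by auto
    interpret A: almost_dual "VF V" "m V" "D V" lie_bracket "restrict_vf V e" "restrict_vf V E" "inverse_E V"
      by (rule almost_dual[OF V])
    have rep: "base.curvature_on V X Y Z = 0 \<and>
        D_L V X (D_L V Y Z) - D_L V Y (D_L V X Z) - D_L V (twisted_bracket (mult_op m E) V X Y) Z = 0 \<and>
        mixed_curvature V X Y Z = 0" if X: "X \<in> VF V" "Y \<in> VF V" "Z \<in> VF V" for X Y Z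
    proof -
      let ?\<omega> = "\<lambda>W xs. restrict_vf W Z"
      have "zero_form \<O> V 2 (d_op id_op D (d_op id_op D ?\<omega>)) \<and>
          zero_form \<O> V 2 (d_op (mult_op m E) D_dual (d_op (mult_op m E) D_dual ?\<omega>)) \<and>
          zero_form \<O> V 2 (d_op id_op D (d_op (mult_op m E) D_dual ?\<omega>) +
            d_op (mult_op m E) D_dual (d_op id_op D ?\<omega>))"
        using bi V constant_tform[OF X(3)] unfolding differential_bicomplex_def
        by (metis add_0)
      then have "d_op id_op D (d_op id_op D ?\<omega>) V [X, Y] = 0 \<and>
          d_op (mult_op m E) D_dual (d_op (mult_op m E) D_dual ?\<omega>) V [X, Y] = 0 \<and>
          d_op id_op D (d_op (mult_op m E) D_dual ?\<omega>) V [X, Y] +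
            d_op (mult_op m E) D_dual (d_op id_op D ?\<omega>) V [X, Y] = 0"
        using V X by (simp add: zero_form_def)
      then show ?thesis
        unfolding d_op_eqs koszul_koszul_0 restrict_vf_id[OF X(3)] A.curvature_def mixed_curvature_def
        by blast
    qed
    show "\<forall>X\<in>VF V. \<forall>Y\<in>VF V. \<forall>Z\<in>VF V. base.curvature_on V X Y Z = 0 \<and>
        dual_sheaf.curvature_on V X Y Z = 0 \<and> mixed_curvature V X Y Z = 0"
    proof (intro ballI)
      fix X Y Z assume X: "X \<in> VF V" "Y \<in> VF V" "Z \<in> VF V"
      \<comment> \<open>The second equation of the bicomplex gives \<open>R\<^sup>*(L X', L Y') = 0\<close>; take \<open>X' = L\<^sup>-\<^sup>1 X\<close> and \<open>Y' = L\<^sup>-\<^sup>1 Y\<close>.\<close>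
      let ?F = "m V (inverse_E V)"
      have F: "?F X \<in> VF V" "?F Y \<in> VF V" using X by simp_all
      have "A.dual.curvature X Y Z = 0"
        using rep[OF F X(3)] A.dual_representation_eq[OF F X(3)] F X A.twisted_closed[OF F]
        by (simp add: dual_D_eq[OF V] local_dual_eqs(3)[OF V F F(1)])
      then show "base.curvature_on V X Y Z = 0 \<and>
          dual_sheaf.curvature_on V X Y Z = 0 \<and> mixed_curvature V X Y Z = 0"
        using rep[OF X] local_dual_eqs(1)[OF V X] by simp
    qed
  qed
next
  assume van: bicomplex_curvatures_vanish
  show "differential_bicomplex \<O> U (d_op id_op D) (d_op (mult_op m E) D_dual)"
    unfolding differential_bicomplex_def zero_form_def
  proof (intro allI impI ballI)
    fix V k \<omega>
    assume "open V \<and> V \<subseteq> U" and \<omega>: "\<omega> \<in> tforms \<O> V k"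
    have main: "d_op id_op D (d_op id_op D \<omega>) W xs = 0 \<and>
          d_op (mult_op m E) D_dual (d_op (mult_op m E) D_dual \<omega>) W xs = 0 \<and>
          d_op id_op D (d_op (mult_op m E) D_dual \<omega>) W xs + d_op (mult_op m E) D_dual (d_op id_op D \<omega>) W xs = 0"
      if W: "open W" "W \<subseteq> V" and xs: "set xs \<subseteq> VF W" "length xs = k + 2" for W xs
    proof -
      have WU: "W \<subseteq> U" using W \<open>open V \<and> V \<subseteq> U\<close> by auto
      interpret A: almost_dual "VF W" "m W" "D W" lie_bracket "restrict_vf W e" "restrict_vf W E" "inverse_E W"
        by (rule almost_dual[OF W(1) WU])
      have flat: "A.curvature X Y Z = 0" and dual_flat: "A.dual.curvature X Y Z = 0" and mixed: "A.mixed X Y Z = 0"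
        if "X \<in> VF W" "Y \<in> VF W" "Z \<in> VF W" for X Y Z
        using van that W(1) WU local_dual_eqs(1,4)[OF W(1) WU that] by (auto simp: bicomplex_curvatures_vanish_def)
      note tw = local_dual_eqs(3)[OF W(1) WU _ _ zero_VF]
      note dl = dual_D_eq[OF W(1) WU]
      have 1: "lie_representation (VF W) (D W) lie_bracket"
        by (rule A.lie_representation_if_flat[OF flat])
      have 2: "lie_representation (VF W) (D_L W) (twisted_bracket (mult_op m E) W)"
        using A.lie_representation_dual[OF flat dual_flat]
        by (rule lie_representation_cong) (simp_all add: dl tw)
      have 3: "lie_representation (VF W) (\<lambda>X Z. D W X Z + D_L W X Z)
          (\<lambda>X Y. lie_bracket X Y + twisted_bracket (mult_op m E) W X Y)"
        using A.lie_representation_sum[OF flat dual_flat mixed]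
        by (rule lie_representation_cong) (simp_all add: dl tw)
      note b1 = lie_representation.axioms(1)[OF 1] and b2 = lie_representation.axioms(1)[OF 2]
      note skew = tforms_skew[OF \<omega> W]
      show ?thesis
        unfolding d_op_eqs koszul_koszul[OF b1 b1 skew xs] koszul_koszul[OF b2 b2 skew xs]
          koszul_koszul[OF b1 b2 skew xs] koszul_koszul[OF b2 b1 skew xs]
        using lie_representation.cd_square[OF 1 skew xs(1)] lie_representation.cd_square[OF 2 skew xs(1)]
          cartan_d_anticommute[OF 1 2 3 skew xs(1)] by blast
    qed
    then show "(\<forall>W. open W \<and> W \<subseteq> V \<longrightarrow> (\<forall>xs. set xs \<subseteq> VF W \<and> length xs = k + 2 \<longrightarrow>
            d_op id_op D (d_op id_op D \<omega>) W xs = 0)) \<and>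
        (\<forall>W. open W \<and> W \<subseteq> V \<longrightarrow> (\<forall>xs. set xs \<subseteq> VF W \<and> length xs = k + 2 \<longrightarrow>
            d_op (mult_op m E) D_dual (d_op (mult_op m E) D_dual \<omega>) W xs = 0)) \<and>
        (\<forall>W. open W \<and> W \<subseteq> V \<longrightarrow> (\<forall>xs. set xs \<subseteq> VF W \<and> length xs = k + 2 \<longrightarrow>
            (d_op id_op D (d_op (mult_op m E) D_dual \<omega>) + d_op (mult_op m E) D_dual (d_op id_op D \<omega>)) W xs = 0))"
      by simp
  qed
qed

text \<open>
  The bicomplex lives over \<open>U\<close>, but a bi-flat structure requires \<open>(D, \<circ>, e)\<close> to be a flat F-structure over
  the whole manifold.
\<close>
lemma extend_from_dense:
  assumes van: "\<And>V X Y Z. open V \<Longrightarrow> V \<subseteq> U \<Longrightarrow> X \<in> VF V \<Longrightarrow> Y \<in> VF V \<Longrightarrow> Z \<in> VF V \<Longrightarrow>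
      base.curvature_on V X Y Z = 0 \<and> base.codazzi_on V X Y Z = 0"
    and V: "open V" and X: "X \<in> VF V" "Y \<in> VF V" "Z \<in> VF V"
  shows "base.curvature_on V X Y Z = 0 \<and> base.codazzi_on V X Y Z = 0"
proof -
  let ?W = "V \<inter> U"
  have W: "open ?W" "?W \<subseteq> V" "?W \<subseteq> U" using V U_open by auto
  let ?r = "restrict_vf ?W"
  interpret A: euler_algebra "VF V" "m V" "D V" lie_bracket "restrict_vf V e" "restrict_vf V E"
    by (rule euler_algebra[OF V])
  interpret B: euler_algebra "VF ?W" "m ?W" "D ?W" lie_bracket "restrict_vf ?W e" "restrict_vf ?W E"
    by (rule euler_algebra[OF W(1)])
  note [simp] = base.m_restrict[OF V _ _ _ W(1,2)] base.D_restrict[OF V _ _ _ W(1,2)] restrict_vf_bracket X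
  have rX: "?r X \<in> VF ?W" "?r Y \<in> VF ?W" "?r Z \<in> VF ?W"
    using X[THEN restrict_VF, OF W(2)] by simp_all
  have "?r (A.curvature X Y Z) = B.curvature (?r X) (?r Y) (?r Z)"
    by (simp add: A.curvature_def B.curvature_def)
  moreover have "?r (A.codazzi X Y Z) = B.codazzi (?r X) (?r Y) (?r Z)"
    by (simp add: A.codazzi_def B.codazzi_def)
  ultimately have "?r (A.curvature X Y Z) = 0" "?r (A.codazzi X Y Z) = 0"
    using van[OF W(1,3) rX] by simp_all
  moreover have "A.curvature X Y Z \<in> VF V" "A.codazzi X Y Z \<in> VF V"
    by (simp_all add: A.curvature_def A.codazzi_def)
  ultimately show ?thesis
    using vf_eq_zero_if_dense[OF V _ U_open U_dense] by blast
qed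

lemma curvatures_iff_biflat:
  "bicomplex_curvatures_vanish \<longleftrightarrow>
     flat_F_structure \<O> UNIV D m e \<and> flat_F_structure \<O> U D_dual m_dual (restrict_vf U E)"
  (is "_ \<longleftrightarrow> ?R")
proof
  assume van: bicomplex_curvatures_vanish
  have main: "base.curvature_on V X Y Z = 0 \<and> base.codazzi_on V X Y Z = 0 \<and>
      dual_sheaf.curvature_on V X Y Z = 0 \<and> dual_sheaf.codazzi_on V X Y Z = 0"
    if V: "open V" "V \<subseteq> U" and X: "X \<in> VF V" "Y \<in> VF V" "Z \<in> VF V" for V X Y Z
  proof -
    interpret A: almost_dual "VF V" "m V" "D V" lie_bracket "restrict_vf V e" "restrict_vf V E" "inverse_E V"
      by (rule almost_dual[OF V])
    have flat: "A.curvature X Y Z = 0" and mixed: "A.mixed X Y Z = 0"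
      if "X \<in> VF V" "Y \<in> VF V" "Z \<in> VF V" for X Y Z
      using van that V local_dual_eqs(4)[OF V that] by (auto simp: bicomplex_curvatures_vanish_def)
    have codazzi: "A.codazzi X Y Z = 0" if "X \<in> VF V" "Y \<in> VF V" "Z \<in> VF V" for X Y Z
      using A.codazzi_if_mixed[OF flat mixed nabla_E_inj[OF V(1)]] that by blast
    have "A.dual.codazzi X Y Z = 0"
      using A.dual_codazzi[OF codazzi] X by blast
    then show ?thesis
      using van V X codazzi[OF X] local_dual_eqs(2)[OF V X] by (auto simp: bicomplex_curvatures_vanish_def)
  qed
  have "base.curvature_on V X Y Z = 0 \<and> base.codazzi_on V X Y Z = 0"
    if "open V" "X \<in> VF V" "Y \<in> VF V" "Z \<in> VF V" for V X Y Z
    by (rule extend_from_dense[OF _ that]) (simp add: main)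
  then show ?R
    unfolding base.flat_F_structure_iff dual_sheaf.flat_F_structure_iff by (simp add: main)
next
  assume R: ?R
  show bicomplex_curvatures_vanish
    unfolding bicomplex_curvatures_vanish_def
  proof (intro allI impI ballI)
    fix V X Y Z assume "open V \<and> V \<subseteq> U" and X: "X \<in> VF V" "Y \<in> VF V" "Z \<in> VF V"
    then have V: "open V" "V \<subseteq> U" by auto
    interpret A: almost_dual "VF V" "m V" "D V" lie_bracket "restrict_vf V e" "restrict_vf V E" "inverse_E V"
      by (rule almost_dual[OF V])
    have flat: "A.curvature X Y Z = 0" and codazzi: "A.codazzi X Y Z = 0"
      and dual_flat: "dual_sheaf.curvature_on V X Y Z = 0"
      if "X \<in> VF V" "Y \<in> VF V" "Z \<in> VF V" for X Y Z
      using R V that unfolding base.flat_F_structure_iff dual_sheaf.flat_F_structure_iff by simp_all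
    have EZ: "m V (restrict_vf V E) Z \<in> VF V" using X by simp
    have "A.mixed X Y Z = 0"
      using A.dual_curvature_eq_mixed[OF codazzi flat X] dual_flat[OF X(1,2) EZ]
        local_dual_eqs(1)[OF V X(1,2) EZ] by simp
    then show "base.curvature_on V X Y Z = 0 \<and> dual_sheaf.curvature_on V X Y Z = 0 \<and> mixed_curvature V X Y Z = 0"
      using flat[OF X] dual_flat[OF X] local_dual_eqs(4)[OF V X] by simp
  qed
qed

text \<open>The two sides differ by \<open>D\<^sub>V E\<close> with \<open>V = Y * (X \<circ> Z) - Z * (X \<circ> Y) = 0\<close>.\<close>
lemma D_D_dual_difference:
  assumes V: "open V" "V \<subseteq> U" and X: "X \<in> VF V" "Y \<in> VF V" "Z \<in> VF V"
  shows "D V Y (m V X Z) - D V Z (m V X Y) = D_dual V Y (m V X Z) - D_dual V Z (m V X Y)"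
proof -
  interpret A: almost_dual "VF V" "m V" "D V" lie_bracket "restrict_vf V e" "restrict_vf V E" "inverse_E V"
    by (rule almost_dual[OF V])
  have "m_dual V Y (m V X Z) = m_dual V Z (m V X Y)"
    using X by (simp add: dual_m_eq[OF V] A.star_def A.p_ac)
  then show ?thesis
    by (simp add: dual_D_unfold)
qed

lemma biflat_iff:
  "biflat_F_structure \<O> U D m e D_dual m_dual E \<longleftrightarrow>
     flat_F_structure \<O> UNIV D m e \<and> flat_F_structure \<O> U D_dual m_dual (restrict_vf U E)"
  unfolding biflat_F_structure_def using euler U_open U_dense mult_E D_D_dual_difference by blast

end

theorem theorem4p3:
  fixes \<O> :: "'p::{t2_space,second_countable_topology} set \<Rightarrow> ('p \<Rightarrow> 'k::real_normed_field) set"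
    and r :: regularity and n :: nat
    and m D :: "('p, 'k) op2" and e E :: "('p, 'k) vfield" and U :: "'p set"
  assumes "manifold_sheaf r n \<O>"
    and "F_manifold \<O> UNIV m e"
    and "euler_field \<O> UNIV m e E"
    and "connection \<O> UNIV D"
    and "torsionless \<O> UNIV D"
    and "parallel \<O> UNIV D e"
    and "invertible_op1 \<O> UNIV (nabla_op D E)"
    and "open U" and "closure U = UNIV"
    and "invertible_op1 \<O> U (mult_op m E)"
  shows "differential_bicomplex \<O> U (d_op id_op D)
           (d_op (mult_op m E) (dual_connection \<O> D m E)) \<longleftrightarrow>
         biflat_F_structure \<O> U D m e (dual_connection \<O> D m E) (dual_product \<O> m E) E"
proof -
  interpret euler_manifold \<O> m D e E U
    using assms by unfold_locales (auto simp: manifold_sheaf_def)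
  show ?thesis
    using bicomplex_iff_curvatures curvatures_iff_biflat biflat_iff by blast
qed

end
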